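(* The following three statements hold. (1) Let $u,v\in L^2(\mathbb{R})$ be such that $|\mathcal{F}_\alpha v|=|\mathcal{F}_\alpha u|$ for every $\alpha\in[-\pi/2,\pi/2]$. Then there exists $c\in\mathbb{C}$ with $|c|=1$ such that $v=cu$. (2) Let $\tau\subset[-\pi/2,\pi/2]$ be either a set of positive (Lebesgue) measure or a set with an accumulation point $\alpha_0\neq 0$. Let $u,v\in L^2(\mathbb{R})$ have compact support and be such that $|\mathcal{F}_\alpha v|=|\mathcal{F}_\alpha u|$ for every $\alpha\in\tau$. Then there exists $c\in\mathbb{C}$ with $|c|=1$ such that $v=cu$. (3) Let $a>0$ and define $(\alpha_k)_{k\in\mathbb{Z}}$ by $\alpha_0=\pi/2$ and $\alpha_k=\arctan\frac{a^2}{k}$ for $k\in\mathbb{Z}\setminus\{0\}$. Let $u,v\in L^2(\mathbb{R})$ have compact support included in $[-a,a]$. If $|\mathcal{F}_{\alpha_k}v|=|\mathcal{F}_{\alpha_k}u|$ for every $k\in\mathbb{Z}$, then there exists $c\in\mathbb{C}$ with $|c|=1$ such that $v=cu$.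
   Context: Fractional Fourier transform on $\mathbb{R}$: for $\alpha\in\mathbb{R}\setminus\pi\mathbb{Z}$ put $c_\alpha=\frac{\exp\left(\frac{i}{2}\left(\alpha-\frac{\pi}{2}\right)\right)}{\sqrt{|\sin\alpha|}}$ and, for $u\in L^1(\mathbb{R})\cap L^2(\mathbb{R})$, $$\mathcal{F}_\alpha u(\xi)=c_\alpha e^{-i\pi \xi^2\cot\alpha}\int_{\mathbb{R}}u(t)e^{-i\pi t^2\cot\alpha}e^{-2i\pi t\xi/\sin\alpha}\,dt .$$ This extends to a unitary operator on $L^2(\mathbb{R})$. For $k\in\mathbb{Z}$, $\mathcal{F}_{2k\pi}u=u$ and $\mathcal{F}_{(2k+1)\pi}u(\xi)=u(-\xi)$. Equalities between elements of $L^2$, or between their moduli, are understood almost everywhere. *)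

theory Defs
  imports "HOL-Analysis.Analysis"
begin

text \<open>
  Elements of L1 and L2 on the real line are represented by Lebesgue measurable functions;
  identities between them are stated almost everywhere.
\<close>

definition L1 :: "(real \<Rightarrow> complex) set" where
  "L1 = {u. integrable lebesgue u}"

definition L2 :: "(real \<Rightarrow> complex) set" where
  "L2 = {u \<in> borel_measurable lebesgue. integrable lebesgue (\<lambda>x. (cmod (u x))\<^sup>2)}"

text \<open>
  The nonnegative integral is used so that a difference that is not square integrable has
  infinite distance; the Bochner integral would give it the value zero.
\<close>

definition tendsto_L2 :: "(nat \<Rightarrow> real \<Rightarrow> complex) \<Rightarrow> (real \<Rightarrow> complex) \<Rightarrow> bool" where
  "tendsto_L2 f g \<longleftrightarrow>
    (\<lambda>n. \<integral>\<^sup>+ x. ennreal ((cmod (f n x - g x))\<^sup>2) \<partial>lebesgue) \<longlonglongrightarrow> 0"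

text \<open>
  Support of a class of functions modulo null sets: the complement of the largest open set on
  which the function vanishes almost everywhere.
\<close>

definition ess_support :: "(real \<Rightarrow> complex) \<Rightarrow> real set" where
  "ess_support u = - \<Union>{U. open U \<and> (AE x in lebesgue. x \<in> U \<longrightarrow> u x = 0)}"

definition frft_const :: "real \<Rightarrow> complex" where
  "frft_const \<alpha> = exp (\<i> / 2 * of_real (\<alpha> - pi / 2)) / of_real (sqrt \<bar>sin \<alpha>\<bar>)"

definition frft_integral :: "real \<Rightarrow> (real \<Rightarrow> complex) \<Rightarrow> real \<Rightarrow> complex" where
  "frft_integral \<alpha> u \<xi> =
    frft_const \<alpha> * exp (- \<i> * of_real (pi * \<xi>\<^sup>2 * cot \<alpha>)) *
    (LINT t|lebesgue. u t * exp (- \<i> * of_real (pi * t\<^sup>2 * cot \<alpha>)) *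
                            exp (- 2 * \<i> * of_real (pi * t * \<xi> / sin \<alpha>)))"

text \<open>
  Graph of the continuous extension to L2 of the integral operator on the intersection of L1
  and L2 (for angles that are not multiples of \<open>pi\<close>), as the closure of the graph of that operator.
\<close>

definition is_frft :: "real \<Rightarrow> (real \<Rightarrow> complex) \<Rightarrow> (real \<Rightarrow> complex) \<Rightarrow> bool" where
  "is_frft \<alpha> u w \<longleftrightarrow> u \<in> L2 \<and> w \<in> L2 \<and>
    (\<exists>f :: nat \<Rightarrow> real \<Rightarrow> complex. (\<forall>n. f n \<in> L1 \<inter> L2) \<and> tendsto_L2 f u \<and>
         tendsto_L2 (\<lambda>n. frft_integral \<alpha> (f n)) w)"

text \<open>
  The choice below is that of a representative of the transform, which is unique up to
  equality almost everywhere.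
\<close>

definition frft :: "real \<Rightarrow> (real \<Rightarrow> complex) \<Rightarrow> real \<Rightarrow> complex" where
  "frft \<alpha> u =
    (if \<exists>k::int. \<alpha> = 2 * of_int k * pi then u
     else if \<exists>k::int. \<alpha> = (2 * of_int k + 1) * pi then (\<lambda>\<xi>. u (- \<xi>))
     else (SOME w. is_frft \<alpha> u w))"

definition sample_angle :: "real \<Rightarrow> int \<Rightarrow> real" where
  "sample_angle a k = (if k = 0 then pi / 2 else arctan (a\<^sup>2 / of_int k))"

end

theory Submission
  imports Defs "HOL-Probability.Probability" "HOL-Complex_Analysis.Complex_Analysis"
begin

text \<open>
  The modulus of a fractional Fourier transform sees its argument only through the correlations
  \<open>u(t + x) * cnj (u t)\<close>. Indeed the Fourier transform of \<open>\<bar>w\<bar>\<^sup>2\<close>, for \<open>w\<close> the transform of \<open>u\<close> at the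
  angle \<open>\<alpha>\<close>, is by Plancherel's formula an autocorrelation of the chirped function
  \<open>u(t) * cis (- pi * t\<^sup>2 * cot \<alpha>)\<close>; up to a unimodular factor it equals the integral over \<open>t\<close> of
  \<open>u(t + x) * cnj (u t) * cis (- 2 * pi * x * cot \<alpha> * t)\<close>. In other words, the phaseless data at the angle
  \<open>\<alpha>\<close> are the values of the ambiguity function of \<open>u\<close> on a line of slope \<open>cot \<alpha>\<close>. So if the data of \<open>u\<close> and
  \<open>v\<close> agree, then for every shift \<open>x\<close> the integrable function
  \<open>h\<^sub>x(t) = u(t + x) * cnj (u t) - v(t + x) * cnj (v t)\<close> has a Fourier transform that vanishes at the
  frequency \<open>2 * pi * x * cot \<alpha>\<close> (lemma \<open>ft_shift_product_diff_eq_0\<close>).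

  Each part of the theorem supplies enough such zeros, for every \<open>x \<noteq> 0\<close>, to conclude \<open>h\<^sub>x = 0\<close>.
  When all angles are available, \<open>cot \<alpha>\<close> takes every real value, so the transform of \<open>h\<^sub>x\<close> vanishes
  identically (\<open>ft_unique\<close>). When the supports are compact, that transform is an entire function, and its
  zeros accumulate at a finite point because the angles accumulate away from 0 (\<open>ft_eq_0_of_accumulation\<close>). In the sampled case the zeros form an arithmetic
  progression of step \<open>2 * pi * \<bar>x\<bar> / a\<^sup>2\<close>, while \<open>h\<^sub>x\<close> lives on an interval of length \<open>2 * a - \<bar>x\<bar>\<close>; since
  \<open>\<bar>x\<bar> * (2 * a - \<bar>x\<bar>) \<le> a\<^sup>2\<close>, the vanishing values include a complete set of Fourier coefficients of
  \<open>h\<^sub>x\<close> on its support (\<open>ft_eq_0_of_fourier_coefficients\<close>).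

  Finally, \<open>h\<^sub>x = 0\<close> for almost all \<open>x\<close> says that \<open>u s * cnj (u t) = v s * cnj (v t)\<close> for almost all pairs
  \<open>(s, t)\<close>, and a function is determined up to a unimodular constant by this tensor square
  (\<open>tensor_square_determines_up_to_phase\<close>).

  The graph of the transform on L2 is the closure of its graph on the integrable functions in L2, so the
  existence of a value rests on the isometry property of the latter (\<open>L2norm_frft_ft\<close>) together with the
  completeness of L2 (\<open>L2_complete\<close>). The analysis takes place with Borel functions and Lebesgue-Borel measure, to which
  elements of L2 are reduced by changing them on a null set.
\<close>

section \<open>Continuity of translations in the mean\<close>

lemma shift_integral:
  fixes f :: "real \<Rightarrow> 'a::{banach, second_countable_topology}"
  shows "(LINT t|lborel. f (t + h)) = (LINT t|lborel. f t)"
  using lborel_integral_real_affine[of 1 f h] by (simp add: add.commute)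

lemma shift_integrable:
  fixes f :: "real \<Rightarrow> 'a::{banach, second_countable_topology}"
  shows "integrable lborel (\<lambda>t. f (t + h)) \<longleftrightarrow> integrable lborel f"
  using lborel_integrable_real_affine_iff[of 1 f h] by (simp add: add.commute)

lemma norm_add3_le: "norm (a + b + c) \<le> norm a + norm b + norm (c::'a::real_normed_vector)"
  using norm_triangle_ineq[of "a + b" c] norm_triangle_ineq[of a b] by linarith

text \<open>
  Continuity is stated along sequences because the limits are obtained by dominated convergence.
\<close>
definition L1_shift_continuous :: "(real \<Rightarrow> complex) \<Rightarrow> bool" where
  "L1_shift_continuous f \<longleftrightarrow>
     (\<forall>h. h \<longlonglongrightarrow> 0 \<longrightarrow> (\<lambda>n::nat. LINT t|lborel. cmod (f (t + h n) - f t)) \<longlonglongrightarrow> 0)"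

text \<open>
  Translations are isometries of L1, so approximating \<open>f\<close> within \<open>e / 3\<close> costs \<open>e / 3\<close> twice, uniformly in the shift.
\<close>
lemma L1_shift_continuous_closed:
  assumes f: "integrable lborel f"
    and approx: "\<And>e. e > 0 \<Longrightarrow> \<exists>g. integrable lborel g \<and> (LINT t|lborel. cmod (f t - g t)) < e
          \<and> L1_shift_continuous g"
  shows "L1_shift_continuous f"
  unfolding L1_shift_continuous_def
proof (intro allI impI)
  fix h :: "nat \<Rightarrow> real" assume h: "h \<longlonglongrightarrow> 0"
  show "(\<lambda>n::nat. LINT t|lborel. cmod (f (t + h n) - f t)) \<longlonglongrightarrow> 0"
  proof (rule LIMSEQ_I)
    fix e :: real assume "e > 0"
    then obtain g where g: "integrable lborel g" and gf: "(LINT t|lborel. cmod (f t - g t)) < e/3"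
      and gc: "L1_shift_continuous g" using approx[of "e/3"] by auto
    have "eventually (\<lambda>n. (LINT t|lborel. cmod (g (t + h n) - g t)) < e/3) sequentially"
      using gc h \<open>e > 0\<close> unfolding L1_shift_continuous_def by (intro order_tendstoD(2)[of _ 0]) auto
    then obtain N where N: "\<And>n. n \<ge> N \<Longrightarrow> (LINT t|lborel. cmod (g (t + h n) - g t)) < e/3"
      unfolding eventually_sequentially by auto
    have "norm ((LINT t|lborel. cmod (f (t + h n) - f t)) - 0) < e" if "n \<ge> N" for n
    proof -
      have fs: "integrable lborel (\<lambda>t. f (t + h n))" and gs: "integrable lborel (\<lambda>t. g (t + h n))"
        using f g by (simp_all add: shift_integrable)
      have "(LINT t|lborel. cmod (f (t + h n) - f t)) \<le>
        (LINT t|lborel. cmod (f (t + h n) - g (t + h n)) + cmod (g (t + h n) - g t) + cmod (f t - g t))"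
      proof (rule integral_mono)
        fix t
        have "cmod (f (t + h n) - f t) = cmod ((f (t + h n) - g (t + h n)) + (g (t + h n) - g t) + (g t - f t))"
          by simp
        also have "\<dots> \<le> cmod (f (t + h n) - g (t + h n)) + cmod (g (t + h n) - g t) + cmod (f t - g t)"
          using norm_add3_le[of "f (t + h n) - g (t + h n)" "g (t + h n) - g t" "g t - f t"]
          by (simp add: norm_minus_commute)
        finally show "cmod (f (t + h n) - f t) \<le> cmod (f (t + h n) - g (t + h n)) + cmod (g (t + h n) - g t) + cmod (f t - g t)" .
      qed (use f g fs gs in auto)
      also have "\<dots> = (LINT t|lborel. cmod (f (t + h n) - g (t + h n))) + (LINT t|lborel. cmod (g (t + h n) - g t)) + (LINT t|lborel. cmod (f t - g t))"
        using f g fs gs by simp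
      also have "(LINT t|lborel. cmod (f (t + h n) - g (t + h n))) = (LINT t|lborel. cmod (f t - g t))"
        using shift_integral[of "\<lambda>t. cmod (f t - g t)" "h n"] by simp
      finally show ?thesis using N[OF that] gf by simp
    qed
    then show "\<exists>no. \<forall>n\<ge>no. norm ((LINT t|lborel. cmod (f (t + h n) - f t)) - 0) < e" by blast
  qed
qed

text \<open>
  For an open set, \<open>indicator U (t + h n)\<close> is eventually 1 at each point \<open>t\<close> of \<open>U\<close>; this pointwise convergence
  fails for general measurable sets, which are reached through outer regularity.
\<close>
lemma L1_shift_continuous_open:
  fixes U :: "real set"
  assumes U: "open U" and fin: "emeasure lborel U < \<infinity>"
  shows "L1_shift_continuous (\<lambda>t. indicator U t *\<^sub>R c)"
  unfolding L1_shift_continuous_def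
proof (intro allI impI)
  fix h :: "nat \<Rightarrow> real" assume h: "h \<longlonglongrightarrow> 0"
  have [measurable]: "U \<in> sets borel" using U by simp
  let ?i = "indicator U :: real \<Rightarrow> real"
  have i: "integrable lborel ?i" using fin by (simp add: integrable_indicator_iff)
  have si: "integrable lborel (\<lambda>t. ?i (t + s))" for s using i by (simp add: shift_integrable)
  have ip: "integrable lborel (\<lambda>t. ?i (t + s) * ?i t)" for s
    by (rule Bochner_Integration.integrable_bound[OF i]) (auto simp: indicator_def)
  have lim: "(\<lambda>n. LINT t|lborel. ?i (t + h n) * ?i t) \<longlonglongrightarrow> (LINT t|lborel. ?i t)"
  proof (rule integral_dominated_convergence[where w = ?i])
    show "AE t in lborel. (\<lambda>n. ?i (t + h n) * ?i t) \<longlonglongrightarrow> ?i t"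
    proof (intro AE_I2)
      fix t :: real
      show "(\<lambda>n. ?i (t + h n) * ?i t) \<longlonglongrightarrow> ?i t"
      proof (cases "t \<in> U")
        case True
        have "(\<lambda>n. t + h n) \<longlonglongrightarrow> t" using tendsto_add[OF tendsto_const[of t] h] by simp
        then have "eventually (\<lambda>n. t + h n \<in> U) sequentially"
          using U True by (rule topological_tendstoD)
        then show ?thesis
          by (intro tendsto_eventually) (auto elim!: eventually_mono simp: True)
      qed simp
    qed
  qed (use i in \<open>auto simp: indicator_def\<close>)
  have eq: "(LINT t|lborel. cmod (?i (t + s) *\<^sub>R c - ?i t *\<^sub>R c))
      = (2 * (LINT t|lborel. ?i t) - 2 * (LINT t|lborel. ?i (t + s) * ?i t)) * cmod c" for s
  proof -
    \<comment> \<open>The distance of two indicators \<open>p\<close> and \<open>q\<close> is \<open>p + q - 2 * p * q\<close>.\<close>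
    have "(LINT t|lborel. cmod (?i (t + s) *\<^sub>R c - ?i t *\<^sub>R c))
       = (LINT t|lborel. (?i (t + s) + ?i t - 2 * (?i (t + s) * ?i t)) * cmod c)"
      by (intro Bochner_Integration.integral_cong) (auto simp: indicator_def)
    also have "\<dots> = ((LINT t|lborel. ?i (t + s)) + (LINT t|lborel. ?i t) - 2 * (LINT t|lborel. ?i (t + s) * ?i t)) * cmod c"
      using i si[of s] ip[of s] by simp
    finally show ?thesis using shift_integral[of ?i s] by simp
  qed
  have "(\<lambda>n. (2 * (LINT t|lborel. ?i t) - 2 * (LINT t|lborel. ?i (t + h n) * ?i t)) * cmod c) \<longlonglongrightarrow>
     (2 * (LINT t|lborel. ?i t) - 2 * (LINT t|lborel. ?i t)) * cmod c"
    by (intro tendsto_intros lim)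
  then show "(\<lambda>n::nat. LINT t|lborel. cmod (?i (t + h n) *\<^sub>R c - ?i t *\<^sub>R c)) \<longlonglongrightarrow> 0"
    unfolding eq by simp
qed

lemma L1_shift_continuous:
  assumes "integrable lborel f"
  shows "L1_shift_continuous f"
  using assms
proof (induction f rule: integrable_induct)
  case (base A c)
  have [measurable]: "A \<in> sets borel" using base by simp
  show ?case
  proof (rule L1_shift_continuous_closed)
    show "integrable lborel (\<lambda>x. indicat_real A x *\<^sub>R c)"
      using base by (simp add: integrable_indicator_iff)
    fix e :: real assume "e > 0"
    \<comment> \<open>The summand 1 guards against \<open>c = 0\<close>.\<close>
    define d where "d = e / (cmod c + 1)"
    have "d > 0" using \<open>e > 0\<close> by (simp add: d_def add_nonneg_pos)
    obtain U where U: "open U" "A \<subseteq> U" "emeasure lborel (U - A) < ennreal d"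
      using outer_regular_lborel[of A d] \<open>d > 0\<close> by auto
    have [measurable]: "U \<in> sets borel" using U by simp
    have "emeasure lborel U = emeasure lborel A + emeasure lborel (U - A)"
      using U(2) by (subst plus_emeasure) (simp_all add: Un_absorb1)
    also have "\<dots> < \<infinity>"
      using base(2) U(3) by (simp add: ennreal_add_less_top order_less_trans[OF U(3)])
    finally have fin: "emeasure lborel U < \<infinity>" .
    have "(LINT t|lborel. cmod (indicat_real A t *\<^sub>R c - indicat_real U t *\<^sub>R c)) =
       (LINT t|lborel. indicat_real (U - A) t * cmod c)"
      using U(2) by (intro Bochner_Integration.integral_cong) (auto simp: indicator_def)
    also have "\<dots> = measure lborel (U - A) * cmod c" by simp
    also have "\<dots> \<le> d * cmod c"
      using U(3) \<open>d > 0\<close> by (intro mult_right_mono) (simp_all add: measure_def enn2real_leI less_imp_le)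
    also have "\<dots> < e" using \<open>e > 0\<close> by (simp add: d_def field_simps add_pos_nonneg)
    finally have "(LINT t|lborel. cmod (indicat_real A t *\<^sub>R c - indicat_real U t *\<^sub>R c)) < e" .
    with L1_shift_continuous_open[OF U(1) fin, of c] fin
    show "\<exists>g. integrable lborel g \<and> (LINT t|lborel. cmod (indicat_real A t *\<^sub>R c - g t)) < e \<and> L1_shift_continuous g"
      by (intro exI[of _ "\<lambda>t. indicat_real U t *\<^sub>R c"]) (auto simp: integrable_indicator_iff)
  qed
next
  case (add f g)
  have fint: "integrable lborel f" and gint: "integrable lborel g" and fc: "L1_shift_continuous f"
    and gc: "L1_shift_continuous g" using add.hyps add.IH by simp_all
  show ?case unfolding L1_shift_continuous_def
  proof (intro allI impI)
    fix h :: "nat \<Rightarrow> real" assume h: "h \<longlonglongrightarrow> 0"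
    have fs: "integrable lborel (\<lambda>t. f (t + h n))" and gs: "integrable lborel (\<lambda>t. g (t + h n))" for n
      using fint gint by (simp_all add: shift_integrable)
    have "(\<lambda>n. (LINT t|lborel. cmod (f (t + h n) - f t)) + (LINT t|lborel. cmod (g (t + h n) - g t))) \<longlonglongrightarrow> 0 + 0"
      using fc gc h unfolding L1_shift_continuous_def by (intro tendsto_add) auto
    then have sum0: "(\<lambda>n. (LINT t|lborel. cmod (f (t + h n) - f t)) + (LINT t|lborel. cmod (g (t + h n) - g t))) \<longlonglongrightarrow> 0"
      by simp
    show "(\<lambda>n. LINT t|lborel. cmod (f (t + h n) + g (t + h n) - (f t + g t))) \<longlonglongrightarrow> 0"
    proof (rule Lim_null_comparison[OF _ sum0])
      show "\<forall>\<^sub>F n in sequentially. norm (LINT t|lborel. cmod (f (t + h n) + g (t + h n) - (f t + g t)))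
        \<le> (LINT t|lborel. cmod (f (t + h n) - f t)) + (LINT t|lborel. cmod (g (t + h n) - g t))"
      proof (rule always_eventually, rule allI)
        fix n
        have "(LINT t|lborel. cmod (f (t + h n) + g (t + h n) - (f t + g t)))
           \<le> (LINT t|lborel. cmod (f (t + h n) - f t) + cmod (g (t + h n) - g t))"
          using fs[of n] gs[of n] fint gint by (intro integral_mono) (simp_all add: norm_diff_triangle_ineq)
        also have "\<dots> = (LINT t|lborel. cmod (f (t + h n) - f t)) + (LINT t|lborel. cmod (g (t + h n) - g t))"
          using fs[of n] gs[of n] fint gint by simp
        finally show "norm (LINT t|lborel. cmod (f (t + h n) + g (t + h n) - (f t + g t)))
          \<le> (LINT t|lborel. cmod (f (t + h n) - f t)) + (LINT t|lborel. cmod (g (t + h n) - g t))" by simp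
      qed
    qed
  qed
next
  case (lim f s)
  have sint: "\<And>i. integrable lborel (s i)" and slim: "\<And>t. (\<lambda>i. s i t) \<longlonglongrightarrow> f t"
    and sb: "\<And>i t. cmod (s i t) \<le> 2 * cmod (f t)" and fint: "integrable lborel f" and sc: "\<And>i. L1_shift_continuous (s i)"
    using lim.hyps lim.IH by simp_all
  show ?case
  proof (rule L1_shift_continuous_closed)
    show "integrable lborel f" by (rule fint)
    fix e :: real assume "e > 0"
    have [measurable]: "f \<in> borel_measurable borel" "s i \<in> borel_measurable borel" for i
      using borel_measurable_integrable[OF fint] borel_measurable_integrable[OF sint] by simp_all
    have "(\<lambda>n. LINT t|lborel. cmod (f t - s n t)) \<longlonglongrightarrow> (LINT t::real|lborel. (0::real))"
    proof (rule integral_dominated_convergence[where w = "\<lambda>t. 3 * cmod (f t)"])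
      show "AE t in lborel. (\<lambda>n. cmod (f t - s n t)) \<longlonglongrightarrow> 0"
      proof (intro AE_I2)
        fix t show "(\<lambda>n. cmod (f t - s n t)) \<longlonglongrightarrow> 0"
          using tendsto_norm[OF tendsto_diff[OF tendsto_const[of "f t"] slim[of t]]] by simp
      qed
      show "AE t in lborel. norm (cmod (f t - s n t)) \<le> 3 * cmod (f t)" for n
      proof (intro AE_I2)
        fix t have "cmod (s n t) \<le> 2 * cmod (f t)" using sb[of n t] by simp
        then show "norm (cmod (f t - s n t)) \<le> 3 * cmod (f t)"
          using norm_triangle_ineq4[of "f t" "s n t"] by simp
      qed
    qed (use fint in simp_all)
    then have "eventually (\<lambda>n. (LINT t|lborel. cmod (f t - s n t)) < e) sequentially"
      using \<open>e > 0\<close> order_tendstoD(2) by fastforce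
    then obtain n where "(LINT t|lborel. cmod (f t - s n t)) < e"
      by (auto simp: eventually_sequentially)
    then show "\<exists>g. integrable lborel g \<and> (LINT t|lborel. cmod (f t - g t)) < e \<and> L1_shift_continuous g"
      using sint[of n] sc[of n] by (intro exI[of _ "s n"] conjI)
  qed
qed

section \<open>Square integrable functions and their correlations\<close>

definition sqint :: "(real \<Rightarrow> complex) \<Rightarrow> bool" where
  "sqint f \<longleftrightarrow> f \<in> borel_measurable borel \<and> integrable lborel (\<lambda>x. (cmod (f x))\<^sup>2)"

definition L2norm :: "(real \<Rightarrow> complex) \<Rightarrow> real" where
  "L2norm f = sqrt (LINT x|lborel. (cmod (f x))\<^sup>2)"

text \<open>
  The weight \<open>e\<close> is a slot for the characters that arise on both sides of Plancherel's formula. At \<open>x = 0\<close>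
  this is the integral of \<open>\<bar>f\<bar>\<^sup>2 * e\<close>, so that spectral densities are covered as well.
\<close>
definition corr :: "(real \<Rightarrow> complex) \<Rightarrow> (real \<Rightarrow> complex) \<Rightarrow> real \<Rightarrow> complex" where
  "corr e f x = (LINT t|lborel. f (t + x) * cnj (f t) * e t)"

lemma sqint_measurable: "sqint f \<Longrightarrow> f \<in> borel_measurable borel"
  by (simp add: sqint_def)

lemma sqint_integrable: "sqint f \<Longrightarrow> integrable lborel (\<lambda>x. (cmod (f x))\<^sup>2)"
  by (simp add: sqint_def)

lemma sqint_shift: "sqint f \<Longrightarrow> sqint (\<lambda>t. f (t + x))"
  using shift_integrable[of "\<lambda>t. (cmod (f t))\<^sup>2" x] by (auto simp: sqint_def)

lemma borel_measurable_cnj [measurable (raw)]: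
  "f \<in> borel_measurable M \<Longrightarrow> (\<lambda>t. cnj (f t)) \<in> borel_measurable M"
  by (rule borel_measurable_continuous_on[OF continuous_on_cnj[OF continuous_on_id]])

lemma sqint_cnj: "sqint f \<Longrightarrow> sqint (\<lambda>t. cnj (f t))"
  by (simp add: sqint_def borel_measurable_cnj)

lemma L2norm_nonneg: "L2norm f \<ge> 0"
  by (simp add: L2norm_def)

lemma L2norm_power2: "(L2norm f)\<^sup>2 = (LINT x|lborel. (cmod (f x))\<^sup>2)"
  by (simp add: L2norm_def)

lemma L2norm_shift: "L2norm (\<lambda>t. f (t + x)) = L2norm f"
  using shift_integral[of "\<lambda>t. (cmod (f t))\<^sup>2" x] by (simp add: L2norm_def)

lemma sqint_bound:
  assumes "sqint g" "f \<in> borel_measurable borel" "\<And>t. cmod (f t) \<le> cmod (g t)"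
  shows "sqint f"
  unfolding sqint_def
proof
  show "integrable lborel (\<lambda>x. (cmod (f x))\<^sup>2)"
    using assms(2) by (intro Bochner_Integration.integrable_bound[OF sqint_integrable[OF assms(1)]])
      (auto intro!: power_mono assms(3))
qed fact

lemma sqint_diff:
  assumes f: "sqint f" and g: "sqint g"
  shows "sqint (\<lambda>t. f t - g t)"
  unfolding sqint_def
proof
  note [measurable] = sqint_measurable[OF f] sqint_measurable[OF g]
  show "(\<lambda>t. f t - g t) \<in> borel_measurable borel" by simp
  show "integrable lborel (\<lambda>x. (cmod (f x - g x))\<^sup>2)"
  proof (rule Bochner_Integration.integrable_bound)
    show "integrable lborel (\<lambda>x. 2 * (cmod (f x))\<^sup>2 + 2 * (cmod (g x))\<^sup>2)"
      using sqint_integrable[OF f] sqint_integrable[OF g] by simp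
    show "AE x in lborel. norm ((cmod (f x - g x))\<^sup>2) \<le> norm (2 * (cmod (f x))\<^sup>2 + 2 * (cmod (g x))\<^sup>2)"
    proof (intro AE_I2)
      fix x
      have "(cmod (f x - g x))\<^sup>2 \<le> (cmod (f x) + cmod (g x))\<^sup>2"
        by (intro power_mono norm_triangle_ineq4) simp
      also have "\<dots> \<le> 2 * (cmod (f x))\<^sup>2 + 2 * (cmod (g x))\<^sup>2"
        using sum_squares_bound[of "cmod (f x)" "cmod (g x)"] by (simp add: power2_sum)
      finally show "norm ((cmod (f x - g x))\<^sup>2) \<le> norm (2 * (cmod (f x))\<^sup>2 + 2 * (cmod (g x))\<^sup>2)" by simp
    qed
  qed simp
qed

lemma sqint_mult_integrable:
  assumes f: "sqint f" and g: "sqint g"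
  shows "integrable lborel (\<lambda>t. f t * g t)"
proof (rule Bochner_Integration.integrable_bound)
  note [measurable] = sqint_measurable[OF f] sqint_measurable[OF g]
  show "(\<lambda>t. f t * g t) \<in> borel_measurable lborel" by simp
  show "integrable lborel (\<lambda>x. (cmod (f x))\<^sup>2 + (cmod (g x))\<^sup>2)"
    using sqint_integrable[OF f] sqint_integrable[OF g] by simp
  show "AE x in lborel. norm (f x * g x) \<le> norm ((cmod (f x))\<^sup>2 + (cmod (g x))\<^sup>2)"
  proof (intro AE_I2)
    fix x
    have "2 * (cmod (f x) * cmod (g x)) \<le> (cmod (f x))\<^sup>2 + (cmod (g x))\<^sup>2"
      using sum_squares_bound[of "cmod (f x)" "cmod (g x)"] by simp
    moreover have "0 \<le> cmod (f x) * cmod (g x)" by simp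
    ultimately show "norm (f x * g x) \<le> norm ((cmod (f x))\<^sup>2 + (cmod (g x))\<^sup>2)"
      unfolding norm_mult real_norm_def by linarith
  qed
qed

lemma Cauchy_Schwarz_L2:
  assumes f: "sqint f" and g: "sqint g"
  shows "(LINT t|lborel. cmod (f t * g t)) \<le> L2norm f * L2norm g"
proof (rule power2_le_imp_le)
  note [measurable] = sqint_measurable[OF f] sqint_measurable[OF g]
  have m: "integrable lborel (\<lambda>t. cmod (f t * g t))" using sqint_mult_integrable[OF f g] by simp
  have "ennreal ((LINT t|lborel. cmod (f t * g t))\<^sup>2) = (\<integral>\<^sup>+t. ennreal (cmod (f t)) * ennreal (cmod (g t)) \<partial>lborel)\<^sup>2"
    using nn_integral_eq_integral[OF m] by (simp add: norm_mult ennreal_mult ennreal_power)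
  also have "\<dots> \<le> (\<integral>\<^sup>+t. (ennreal (cmod (f t)))\<^sup>2 \<partial>lborel) * (\<integral>\<^sup>+t. (ennreal (cmod (g t)))\<^sup>2 \<partial>lborel)"
    by (rule Cauchy_Schwarz_nn_integral) simp_all
  also have "\<dots> = ennreal ((L2norm f * L2norm g)\<^sup>2)"
    using nn_integral_eq_integral[OF sqint_integrable[OF f]] nn_integral_eq_integral[OF sqint_integrable[OF g]]
    by (simp add: ennreal_power power_mult_distrib L2norm_power2 ennreal_mult)
  finally show "(LINT t|lborel. cmod (f t * g t))\<^sup>2 \<le> (L2norm f * L2norm g)\<^sup>2"
    by (simp add: ennreal_le_iff)
qed (simp add: L2norm_nonneg)

lemma corr_integrable:
  assumes f: "sqint f" and e: "e \<in> borel_measurable borel" "\<And>t. cmod (e t) \<le> 1"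
  shows "integrable lborel (\<lambda>t. f (t + x) * cnj (f t) * e t)"
proof (rule Bochner_Integration.integrable_bound)
  note [measurable] = sqint_measurable[OF f] e(1)
  have "sqint (\<lambda>t. cnj (f t))" by (rule sqint_cnj[OF f])
  from sqint_mult_integrable[OF sqint_shift[OF f, of x] this]
  show "integrable lborel (\<lambda>t. f (t + x) * cnj (f t))" .
  show "AE t in lborel. norm (f (t + x) * cnj (f t) * e t) \<le> norm (f (t + x) * cnj (f t))"
    using e(2) by (auto simp: norm_mult mult_left_le)
  show "(\<lambda>t. f (t + x) * cnj (f t) * e t) \<in> borel_measurable lborel" by measurable
qed

text \<open>
  With \<open>f = u + d\<close>, the product \<open>f(t + x) * cnj (f t)\<close> differs from that of \<open>u\<close> by three terms containing \<open>d\<close>,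
  each of which is controlled by the Cauchy-Schwarz inequality, uniformly in the shift and in the weight.
\<close>
lemma corr_perturbation:
  assumes f: "sqint f" and u: "sqint u" and e: "e \<in> borel_measurable borel" "\<And>t. cmod (e t) \<le> 1"
  defines "d \<equiv> \<lambda>t. f t - u t"
  shows "cmod (corr e f x - corr e u x) \<le> (L2norm d)\<^sup>2 + 2 * L2norm d * L2norm u"
proof -
  have d: "sqint d" unfolding d_def by (rule sqint_diff[OF f u])
  have dc: "sqint (\<lambda>t. cnj (d t))" and uc: "sqint (\<lambda>t. cnj (u t))"
    using d u by (simp_all add: sqint_cnj)
  have nc: "L2norm (\<lambda>t. cnj (d t)) = L2norm d" "L2norm (\<lambda>t. cnj (u t)) = L2norm u"
    by (simp_all add: L2norm_def)
  have i1: "integrable lborel (\<lambda>t. d (t + x) * cnj (d t))"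
    and i2: "integrable lborel (\<lambda>t. d (t + x) * cnj (u t))"
    and i3: "integrable lborel (\<lambda>t. u (t + x) * cnj (d t))"
    using sqint_mult_integrable sqint_shift d u dc uc by auto
  have "corr e f x - corr e u x = (LINT t|lborel. f (t + x) * cnj (f t) * e t - u (t + x) * cnj (u t) * e t)"
    unfolding corr_def using corr_integrable[OF f e] corr_integrable[OF u e] by simp
  also have "cmod \<dots> \<le> (LINT t|lborel. cmod (d (t + x) * cnj (d t)) + cmod (d (t + x) * cnj (u t)) + cmod (u (t + x) * cnj (d t)))"
  proof (rule Bochner_Integration.integral_norm_bound_integral)
    show "integrable lborel (\<lambda>t. f (t + x) * cnj (f t) * e t - u (t + x) * cnj (u t) * e t)"
      using corr_integrable[OF f e] corr_integrable[OF u e] by simp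
    show "integrable lborel (\<lambda>t. cmod (d (t + x) * cnj (d t)) + cmod (d (t + x) * cnj (u t)) + cmod (u (t + x) * cnj (d t)))"
      using i1 i2 i3 by simp
    fix t
    have "f (t + x) * cnj (f t) * e t - u (t + x) * cnj (u t) * e t
       = (d (t + x) * cnj (d t) + d (t + x) * cnj (u t) + u (t + x) * cnj (d t)) * e t"
      by (simp add: d_def algebra_simps)
    also have "cmod \<dots> \<le> cmod (d (t + x) * cnj (d t) + d (t + x) * cnj (u t) + u (t + x) * cnj (d t))"
      using e(2)[of t] by (simp add: norm_mult mult_left_le)
    also have "\<dots> \<le> cmod (d (t + x) * cnj (d t)) + cmod (d (t + x) * cnj (u t)) + cmod (u (t + x) * cnj (d t))"
      by (rule norm_add3_le)
    finally show "cmod (f (t + x) * cnj (f t) * e t - u (t + x) * cnj (u t) * e t) \<le> \<dots>" .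
  qed
  also have "\<dots> = (LINT t|lborel. cmod (d (t + x) * cnj (d t))) + (LINT t|lborel. cmod (d (t + x) * cnj (u t)))
     + (LINT t|lborel. cmod (u (t + x) * cnj (d t)))"
    using i1 i2 i3 by simp
  also have "\<dots> \<le> L2norm d * L2norm d + L2norm d * L2norm u + L2norm u * L2norm d"
    using Cauchy_Schwarz_L2[OF sqint_shift[OF d, of x] dc] Cauchy_Schwarz_L2[OF sqint_shift[OF d, of x] uc]
      Cauchy_Schwarz_L2[OF sqint_shift[OF u, of x] dc]
    by (intro add_mono) (simp_all add: L2norm_shift nc)
  finally show ?thesis by (simp add: power2_eq_square algebra_simps)
qed

lemma corr_limit:
  assumes f: "\<And>n::nat. sqint (f n)" and u: "sqint u" and e: "e \<in> borel_measurable borel" "\<And>t. cmod (e t) \<le> 1"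
    and lim: "(\<lambda>n. L2norm (\<lambda>t. f n t - u t)) \<longlonglongrightarrow> 0"
  shows "(\<lambda>n. corr e (f n) x) \<longlonglongrightarrow> corr e u x"
proof (rule LIM_zero_cancel, rule Lim_null_comparison)
  let ?N = "\<lambda>n. L2norm (\<lambda>t. f n t - u t)"
  show "\<forall>\<^sub>F n in sequentially. norm (corr e (f n) x - corr e u x) \<le> (?N n)\<^sup>2 + 2 * ?N n * L2norm u"
    using corr_perturbation[OF f u e] by (intro always_eventually) simp
  have "(\<lambda>n. (?N n)\<^sup>2 + 2 * ?N n * L2norm u) \<longlonglongrightarrow> 0\<^sup>2 + 2 * 0 * L2norm u"
    by (intro tendsto_intros lim)
  then show "(\<lambda>n. (?N n)\<^sup>2 + 2 * ?N n * L2norm u) \<longlonglongrightarrow> 0" by simp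
qed

lemma corr_bounded:
  assumes u: "sqint u"
  shows "cmod (corr (\<lambda>_. 1) u x) \<le> (L2norm u)\<^sup>2"
  using corr_perturbation[OF u, of "\<lambda>_. 0" "\<lambda>_. 1" x]
  by (simp add: sqint_def L2norm_def corr_def)

lemma truncation_tendsto:
  assumes u: "sqint u" and meas: "\<And>n. Measurable.pred borel (P n)"
    and ev: "\<And>t. \<forall>\<^sub>F n in sequentially. P n t"
  shows "(\<lambda>n. L2norm (\<lambda>t. (if P n t then u t else 0) - u t)) \<longlonglongrightarrow> 0"
proof -
  note [measurable] = sqint_measurable[OF u] meas
  have "(\<lambda>n. LINT t|lborel. (cmod ((if P n t then u t else 0) - u t))\<^sup>2) \<longlonglongrightarrow> (LINT t::real|lborel. (0::real))"
  proof (rule integral_dominated_convergence[where w = "\<lambda>t. (cmod (u t))\<^sup>2"])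
    show "AE t in lborel. (\<lambda>n. (cmod ((if P n t then u t else 0) - u t))\<^sup>2) \<longlonglongrightarrow> 0"
    proof (intro AE_I2 tendsto_eventually)
      fix t
      show "\<forall>\<^sub>F n in sequentially. (cmod ((if P n t then u t else 0) - u t))\<^sup>2 = 0"
        using ev[of t] by (rule eventually_mono) simp
    qed
  qed (use sqint_integrable[OF u] in auto)
  then have "(\<lambda>n. sqrt (LINT t|lborel. (cmod ((if P n t then u t else 0) - u t))\<^sup>2)) \<longlonglongrightarrow> sqrt 0"
    by (intro tendsto_real_sqrt) simp
  then show ?thesis by (simp add: L2norm_def)
qed

text \<open>
  A bounded factor can be pulled out, leaving the L1 distance between two translates.
\<close>
lemma corr_continuous_bounded:
  assumes u: "integrable lborel u" and M: "\<And>t. cmod (u t) \<le> M" and y: "y \<longlonglongrightarrow> x"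
  shows "(\<lambda>n::nat. corr (\<lambda>_. 1) u (y n)) \<longlonglongrightarrow> corr (\<lambda>_. 1) u x"
proof (rule LIM_zero_cancel, rule Lim_null_comparison)
  note [measurable] = borel_measurable_integrable[OF u]
  have us: "integrable lborel (\<lambda>t. u (t + s))" for s using u by (simp add: shift_integrable)
  have bi: "integrable lborel (\<lambda>t. u (t + s) * cnj (u t))" for s
  proof (rule Bochner_Integration.integrable_bound)
    show "integrable lborel (\<lambda>t. M * cmod (u (t + s)))" using us[of s] by simp
    show "AE t in lborel. norm (u (t + s) * cnj (u t)) \<le> norm (M * cmod (u (t + s)))"
    proof (intro AE_I2)
      fix t
      have "M \<ge> 0" using order_trans[OF norm_ge_zero M[of t]] .
      then show "norm (u (t + s) * cnj (u t)) \<le> norm (M * cmod (u (t + s)))"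
        using mult_right_mono[OF M[of t], of "cmod (u (t + s))"] by (simp add: norm_mult abs_mult mult.commute)
    qed
  qed simp
  show "\<forall>\<^sub>F n in sequentially. norm (corr (\<lambda>_. 1) u (y n) - corr (\<lambda>_. 1) u x)
     \<le> M * (LINT t|lborel. cmod (u (t + (y n - x)) - u t))"
  proof (rule always_eventually, rule allI)
    fix n
    have "corr (\<lambda>_. 1) u (y n) - corr (\<lambda>_. 1) u x = (LINT t|lborel. u (t + y n) * cnj (u t) - u (t + x) * cnj (u t))"
      using bi by (simp add: corr_def)
    also have "cmod \<dots> \<le> (LINT t|lborel. M * cmod (u (t + y n) - u (t + x)))"
    proof (rule Bochner_Integration.integral_norm_bound_integral)
      fix t
      have "cmod (u (t + y n) * cnj (u t) - u (t + x) * cnj (u t)) = cmod (u t) * cmod (u (t + y n) - u (t + x))"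
        unfolding left_diff_distrib[symmetric] norm_mult by simp
      also have "\<dots> \<le> M * cmod (u (t + y n) - u (t + x))" by (intro mult_right_mono M) simp
      finally show "cmod (u (t + y n) * cnj (u t) - u (t + x) * cnj (u t)) \<le> \<dots>" .
    qed (use bi us in auto)
    also have "\<dots> = M * (LINT t|lborel. cmod (u ((t + x) + (y n - x)) - u (t + x)))" by simp
    also have "(LINT t|lborel. cmod (u ((t + x) + (y n - x)) - u (t + x))) = (LINT t|lborel. cmod (u (t + (y n - x)) - u t))"
      by (rule shift_integral)
    finally show "norm (corr (\<lambda>_. 1) u (y n) - corr (\<lambda>_. 1) u x) \<le> M * (LINT t|lborel. cmod (u (t + (y n - x)) - u t))" .
  qed
  have "(\<lambda>n. y n - x) \<longlonglongrightarrow> 0" using y by (rule LIM_zero)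
  then have "(\<lambda>n. LINT t|lborel. cmod (u (t + (y n - x)) - u t)) \<longlonglongrightarrow> 0"
    using L1_shift_continuous[OF u] unfolding L1_shift_continuous_def by blast
  then show "(\<lambda>n. M * (LINT t|lborel. cmod (u (t + (y n - x)) - u t))) \<longlonglongrightarrow> 0"
    by (rule tendsto_mult_right_zero)
qed

text \<open>
  Truncating the values of \<open>u\<close> approximates its correlation uniformly by correlations of bounded functions.
\<close>
lemma corr_continuous:
  assumes u: "integrable lborel u" "sqint u" and y: "y \<longlonglongrightarrow> x"
  shows "(\<lambda>n::nat. corr (\<lambda>_. 1) u (y n)) \<longlonglongrightarrow> corr (\<lambda>_. 1) u x"
proof (rule LIMSEQ_I)
  note [measurable] = sqint_measurable[OF u(2)]
  let ?c = "corr (\<lambda>_. 1)"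
  define v where "v k t = (if cmod (u t) \<le> real k then u t else 0)" for k t
  have v: "sqint (v k)" "integrable lborel (v k)" "cmod (v k t) \<le> real k" for k t
    unfolding v_def
    by (rule sqint_bound[OF u(2)], simp, simp)
      (rule Bochner_Integration.integrable_bound[OF u(1)], auto)
  define N where "N k = L2norm (\<lambda>t. v k t - u t)" for k
  have "\<forall>\<^sub>F k in sequentially. cmod (u t) \<le> real k" for t
    by (rule eventually_mono[OF filterlim_at_top[THEN iffD1, OF filterlim_real_sequentially, rule_format, of "cmod (u t)"]])
  then have "N \<longlonglongrightarrow> 0"
    unfolding N_def v_def by (intro truncation_tendsto[OF u(2)]) simp_all
  then have "(\<lambda>k. (N k)\<^sup>2 + 2 * N k * L2norm u) \<longlonglongrightarrow> 0\<^sup>2 + 2 * 0 * L2norm u"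
    by (intro tendsto_intros)
  then have N0: "(\<lambda>k. (N k)\<^sup>2 + 2 * N k * L2norm u) \<longlonglongrightarrow> 0" by simp
  fix e :: real assume "e > 0"
  have "eventually (\<lambda>k. (N k)\<^sup>2 + 2 * N k * L2norm u < e / 3) sequentially"
    using N0 \<open>e > 0\<close> by (intro order_tendstoD(2)) auto
  then obtain k where k: "(N k)\<^sup>2 + 2 * N k * L2norm u < e / 3"
    by (auto simp: eventually_sequentially)
  have near: "cmod (?c (v k) s - ?c u s) < e / 3" for s
    using corr_perturbation[OF v(1)[of k] u(2), of "\<lambda>_. 1" s] k unfolding N_def by simp
  obtain n0 where n0: "\<And>n. n \<ge> n0 \<Longrightarrow> cmod (?c (v k) (y n) - ?c (v k) x) < e / 3"
    using LIMSEQ_D[OF corr_continuous_bounded[OF v(2)[of k] v(3)[of k] y], of "e/3"] \<open>e > 0\<close> by auto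
  have "norm (?c u (y n) - ?c u x) < e" if "n \<ge> n0" for n
  proof -
    have "cmod (?c u (y n) - ?c u x) \<le> cmod (?c (v k) (y n) - ?c (v k) x) + cmod (?c u (y n) - ?c (v k) (y n)) + cmod (?c (v k) x - ?c u x)"
      using norm_add3_le[of "?c (v k) (y n) - ?c (v k) x" "?c u (y n) - ?c (v k) (y n)" "?c (v k) x - ?c u x"] by simp
    moreover have "cmod (?c u (y n) - ?c (v k) (y n)) < e / 3"
      using near[of "y n"] by (simp only: norm_minus_commute[of "?c u (y n)"])
    ultimately show ?thesis using n0[OF that] near[of x] by linarith
  qed
  then show "\<exists>no. \<forall>n\<ge>no. norm (?c u (y n) - ?c u x) < e" by blast
qed

section \<open>Plancherel's formula for correlations\<close>

lemma borel_measurable_cis [measurable (raw)]: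
  "f \<in> borel_measurable M \<Longrightarrow> (\<lambda>t. cis (f t)) \<in> borel_measurable M"
  by (rule borel_measurable_continuous_on[OF continuous_on_cis[OF continuous_on_id]])

text \<open>
  The angular normalisation makes translations and characters free of constants; the factor
  \<open>2 * pi\<close> surfaces only in Plancherel's formula and in the rescaling of the fractional transform.
\<close>
definition ft :: "(real \<Rightarrow> complex) \<Rightarrow> real \<Rightarrow> complex" where
  "ft g \<eta> = (LINT t|lborel. g t * cis (- (\<eta> * t)))"

lemma integrable_mult_unimodular:
  assumes "integrable M f" "e \<in> borel_measurable M" "\<And>t. cmod (e t) \<le> 1"
  shows "integrable M (\<lambda>t. f t * e t)"
proof (rule Bochner_Integration.integrable_bound[OF assms(1)])
  show "AE t in M. norm (f t * e t) \<le> norm (f t)"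
    using assms(3) by (auto simp: norm_mult mult_left_le)
qed (use assms borel_measurable_integrable[OF assms(1)] in simp)

lemma ft_integrable:
  "integrable lborel g \<Longrightarrow> a \<in> borel_measurable borel \<Longrightarrow> integrable lborel (\<lambda>t::real. g t * cis (a t))"
  by (intro integrable_mult_unimodular) simp_all

lemma ft_measurable [measurable]:
  assumes [measurable]: "g \<in> borel_measurable borel"
  shows "ft g \<in> borel_measurable borel"
  unfolding ft_def[abs_def] by measurable

lemma shift_product_integrable:
  fixes g :: "real \<Rightarrow> complex"
  assumes g: "integrable lborel g"
  shows "integrable (lborel \<Otimes>\<^sub>M lborel) (\<lambda>(t, x). g (t + x) * cnj (g t))"
proof (rule lborel_pair.Fubini_integrable)
  have [measurable]: "g \<in> borel_measurable borel" using borel_measurable_integrable[OF g] by simp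
  have gs: "integrable lborel (\<lambda>x. g (t + x))" for t
    using g shift_integrable[of g t] by (simp add: add.commute)
  have "(LINT x|lborel. cmod (g (t + x) * cnj (g t))) = (LINT x|lborel. cmod (g x)) * cmod (g t)" for t
    using shift_integral[of "\<lambda>x. cmod (g x)" t] by (simp add: norm_mult add.commute)
  then show "integrable lborel (\<lambda>t. LINT x|lborel. norm (case (t, x) of (t, x) \<Rightarrow> g (t + x) * cnj (g t)))"
    using g by simp
  show "AE t in lborel. integrable lborel (\<lambda>x. case (t, x) of (t, x) \<Rightarrow> g (t + x) * cnj (g t))"
    using gs by simp
  show "(\<lambda>(t, x). g (t + x) * cnj (g t)) \<in> borel_measurable (lborel \<Otimes>\<^sub>M lborel)"
    by measurable
qed

lemma corr_integrable_L1:
  assumes g: "integrable lborel g"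
  shows "integrable lborel (corr (\<lambda>_. 1) g)"
  using lborel_pair.integrable_snd[OF shift_product_integrable[OF g]] by (simp add: corr_def[abs_def])

text \<open>
  The convolution theorem for \<open>g\<close> and its reflected conjugate.
\<close>
lemma ft_norm_square:
  assumes g: "integrable lborel g"
  shows "of_real ((cmod (ft g \<eta>))\<^sup>2) = ft (corr (\<lambda>_. 1) g) \<eta>"
proof -
  have [measurable]: "g \<in> borel_measurable borel" using borel_measurable_integrable[OF g] by simp
  let ?G = "\<lambda>t x. g (t + x) * cnj (g t) * cis (- (\<eta> * x))"
  have G: "integrable (lborel \<Otimes>\<^sub>M lborel) (\<lambda>(t, x). ?G t x)"
    using integrable_mult_unimodular[OF shift_product_integrable[OF g], of "\<lambda>(t, x). cis (- (\<eta> * x))"]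
    by (simp add: case_prod_beta')
  have "ft (corr (\<lambda>_. 1) g) \<eta> = (LINT x|lborel. LINT t|lborel. ?G t x)"
    by (simp add: ft_def corr_def)
  also have "\<dots> = (LINT t|lborel. LINT x|lborel. ?G t x)"
    by (rule lborel_pair.Fubini_integral[OF G])
  also have "\<dots> = (LINT t|lborel. cnj (g t * cis (- (\<eta> * t))) * ft g \<eta>)"
  proof (rule Bochner_Integration.integral_cong[OF refl])
    fix t
    have "(LINT x|lborel. ?G t x) = (LINT x|lborel. cnj (g t * cis (- (\<eta> * t))) * (g (x + t) * cis (- (\<eta> * (x + t)))))"
    proof (rule Bochner_Integration.integral_cong[OF refl])
      fix x
      have "cis (- (\<eta> * x)) = cis (\<eta> * t) * cis (- (\<eta> * (x + t)))"
        by (simp add: cis_mult algebra_simps)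
      then show "?G t x = cnj (g t * cis (- (\<eta> * t))) * (g (x + t) * cis (- (\<eta> * (x + t))))"
        by (simp add: cis_cnj add.commute)
    qed
    also have "\<dots> = cnj (g t * cis (- (\<eta> * t))) * (LINT x|lborel. g (x + t) * cis (- (\<eta> * (x + t))))"
      by (rule integral_mult_right_zero)
    also have "(LINT x|lborel. g (x + t) * cis (- (\<eta> * (x + t)))) = ft g \<eta>"
      unfolding ft_def by (rule shift_integral)
    finally show "(LINT x|lborel. ?G t x) = cnj (g t * cis (- (\<eta> * t))) * ft g \<eta>" .
  qed
  also have "\<dots> = (LINT t|lborel. cnj (g t * cis (- (\<eta> * t)))) * ft g \<eta>"
    by (rule integral_mult_left_zero)
  also have "\<dots> = cnj (ft g \<eta>) * ft g \<eta>"
    by (simp only: ft_def Bochner_Integration.integral_cnj)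
  also have "\<dots> = of_real ((cmod (ft g \<eta>))\<^sup>2)"
    by (metis complex_norm_square mult.commute)
  finally show ?thesis by simp
qed

text \<open>
  The characteristic function of the standard normal distribution, rescaled.
\<close>
lemma gaussian_fourier:
  assumes e: "\<epsilon> > 0"
  shows "(LINT \<eta>|lborel. cis (- (\<eta> * s)) * of_real (std_normal_density (\<epsilon> * \<eta>)))
      = of_real (exp (- (s / \<epsilon>)\<^sup>2 / 2) / \<epsilon>)"
proof -
  have c: "of_real (exp (- r\<^sup>2 / 2)) = (LINT z|lborel. of_real (std_normal_density z) * cis (r * z))" for r
  proof -
    have "of_real (exp (- r\<^sup>2 / 2)) = char std_normal_distribution r"
      by (simp add: char_std_normal_distribution)
    also have "\<dots> = (LINT z|lborel. std_normal_density z *\<^sub>R iexp (r * z))"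
      unfolding char_def by (subst integral_density) auto
    finally show ?thesis by (simp add: scaleR_conv_of_real cis_conv_exp)
  qed
  have "of_real (exp (- (s / \<epsilon>)\<^sup>2 / 2)) = (LINT z|lborel. of_real (std_normal_density z) * cis ((- s / \<epsilon>) * z))"
    using c[of "- s / \<epsilon>"] by (simp add: power2_eq_square)
  also have "\<dots> = \<epsilon> *\<^sub>R (LINT \<eta>|lborel. of_real (std_normal_density (\<epsilon> * \<eta>)) * cis ((- s / \<epsilon>) * (\<epsilon> * \<eta>)))"
    using lborel_integral_real_affine[of \<epsilon> "\<lambda>z. of_real (std_normal_density z) * cis ((- s / \<epsilon>) * z)" 0] e by simp
  also have "(LINT \<eta>|lborel. of_real (std_normal_density (\<epsilon> * \<eta>)) * cis ((- s / \<epsilon>) * (\<epsilon> * \<eta>)))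
     = (LINT \<eta>|lborel. cis (- (\<eta> * s)) * of_real (std_normal_density (\<epsilon> * \<eta>)))"
    using e by (intro Bochner_Integration.integral_cong[OF refl]) (simp add: mult.commute)
  finally show ?thesis using e by (simp add: scaleR_conv_of_real field_simps)
qed

lemma integrable_std_normal_scaled: "\<epsilon> > 0 \<Longrightarrow> integrable lborel (\<lambda>\<eta>. std_normal_density (\<epsilon> * \<eta>))"
  using lborel_integrable_real_affine[of std_normal_density \<epsilon> 0] integrable_normal_density[of 1 0] by simp

text \<open>
  Damping by a Gaussian makes the inversion integral of \<open>\<bar>ft g\<bar>\<^sup>2\<close> absolutely convergent, so that Fubini's
  theorem turns it into a Gaussian average of the correlation around \<open>x\<close>.
\<close>
lemma gaussian_mean_of_ft_square:
  assumes g: "integrable lborel g" and e: "\<epsilon> > 0"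
  shows "(LINT \<eta>|lborel. of_real ((cmod (ft g \<eta>))\<^sup>2 * std_normal_density (\<epsilon> * \<eta>)) * cis (\<eta> * x))
     = (LINT z|lborel. corr (\<lambda>_. 1) g (x + \<epsilon> * z) * of_real (exp (- z\<^sup>2 / 2)))"
proof -
  define A where "A = corr (\<lambda>_. 1) g"
  have A: "integrable lborel A" unfolding A_def by (rule corr_integrable_L1[OF g])
  have [measurable]: "A \<in> borel_measurable borel" using borel_measurable_integrable[OF A] by simp
  let ?F = "\<lambda>y \<eta>. A y * (cis (- (\<eta> * (y - x))) * of_real (std_normal_density (\<epsilon> * \<eta>)))"
  have F: "integrable (lborel \<Otimes>\<^sub>M lborel) (\<lambda>(y, \<eta>). ?F y \<eta>)"
  proof (rule lborel_pair.Fubini_integrable)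
    have "(LINT \<eta>|lborel. cmod (?F y \<eta>)) = cmod (A y) * (LINT \<eta>|lborel. std_normal_density (\<epsilon> * \<eta>))" for y
      by (simp add: norm_mult)
    then show "integrable lborel (\<lambda>y. LINT \<eta>|lborel. norm (case (y, \<eta>) of (y, \<eta>) \<Rightarrow> ?F y \<eta>))"
      using A by simp
    have "integrable lborel (\<lambda>\<eta>. of_real (std_normal_density (\<epsilon> * \<eta>)) * cis (- (\<eta> * (y - x))))" for y
      using integrable_std_normal_scaled[OF e] by (intro ft_integrable) auto
    then show "AE y in lborel. integrable lborel (\<lambda>\<eta>. case (y, \<eta>) of (y, \<eta>) \<Rightarrow> ?F y \<eta>)"
      by (simp add: mult.commute)
    show "(\<lambda>(y, \<eta>). ?F y \<eta>) \<in> borel_measurable (lborel \<Otimes>\<^sub>M lborel)" by measurable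
  qed
  have "(LINT \<eta>|lborel. of_real ((cmod (ft g \<eta>))\<^sup>2 * std_normal_density (\<epsilon> * \<eta>)) * cis (\<eta> * x))
     = (LINT \<eta>|lborel. LINT y|lborel. ?F y \<eta>)"
  proof (rule Bochner_Integration.integral_cong[OF refl])
    fix \<eta>
    have "of_real ((cmod (ft g \<eta>))\<^sup>2 * std_normal_density (\<epsilon> * \<eta>)) * cis (\<eta> * x)
       = (LINT y|lborel. A y * cis (- (\<eta> * y))) * (of_real (std_normal_density (\<epsilon> * \<eta>)) * cis (\<eta> * x))"
      using ft_norm_square[OF g, of \<eta>] unfolding ft_def A_def by simp
    also have "\<dots> = (LINT y|lborel. A y * cis (- (\<eta> * y)) * (of_real (std_normal_density (\<epsilon> * \<eta>)) * cis (\<eta> * x)))"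
      by simp
    also have "\<dots> = (LINT y|lborel. ?F y \<eta>)"
    proof (rule Bochner_Integration.integral_cong[OF refl])
      fix y
      have "cis (- (\<eta> * (y - x))) = cis (- (\<eta> * y)) * cis (\<eta> * x)"
        by (simp add: cis_mult algebra_simps)
      then show "A y * cis (- (\<eta> * y)) * (of_real (std_normal_density (\<epsilon> * \<eta>)) * cis (\<eta> * x)) = ?F y \<eta>"
        by simp
    qed
    finally show "of_real ((cmod (ft g \<eta>))\<^sup>2 * std_normal_density (\<epsilon> * \<eta>)) * cis (\<eta> * x) = (LINT y|lborel. ?F y \<eta>)" .
  qed
  also have "\<dots> = (LINT y|lborel. LINT \<eta>|lborel. ?F y \<eta>)"
    by (rule lborel_pair.Fubini_integral[OF F])
  also have "\<dots> = (LINT y|lborel. A y * of_real (exp (- ((y - x) / \<epsilon>)\<^sup>2 / 2) / \<epsilon>))"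
    by (intro Bochner_Integration.integral_cong[OF refl]) (simp only: integral_mult_right_zero gaussian_fourier[OF e])
  also have "\<dots> = \<epsilon> *\<^sub>R (LINT z|lborel. A (x + \<epsilon> * z) * of_real (exp (- z\<^sup>2 / 2) / \<epsilon>))"
    using lborel_integral_real_affine[of \<epsilon> "\<lambda>y. A y * of_real (exp (- ((y - x) / \<epsilon>)\<^sup>2 / 2) / \<epsilon>)" x] e by simp
  also have "\<dots> = (LINT z|lborel. \<epsilon> *\<^sub>R (A (x + \<epsilon> * z) * of_real (exp (- z\<^sup>2 / 2) / \<epsilon>)))"
    by simp
  also have "\<dots> = (LINT z|lborel. A (x + \<epsilon> * z) * of_real (exp (- z\<^sup>2 / 2)))"
    using e by (intro Bochner_Integration.integral_cong[OF refl]) (simp add: scaleR_conv_of_real)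
  finally show ?thesis by (simp add: A_def)
qed

lemma gaussian_integral_exp: "integrable lborel (\<lambda>z::real. exp (- z\<^sup>2 / 2))" "(LINT z|lborel. exp (- z\<^sup>2 / 2)) = sqrt (2 * pi)"
proof -
  have eq: "exp (- z\<^sup>2 / 2) = sqrt (2 * pi) * std_normal_density z" for z :: real
    by (simp add: std_normal_density_def)
  show "integrable lborel (\<lambda>z::real. exp (- z\<^sup>2 / 2))"
    unfolding eq using integrable_normal_density[of 1 0] by simp
  show "(LINT z|lborel. exp (- z\<^sup>2 / 2)) = sqrt (2 * pi)"
    unfolding eq using integral_normal_density[of 1 0] by simp
qed

lemma gaussian_mean_tendsto:
  assumes g: "integrable lborel g" "sqint g"
  shows "(\<lambda>n. LINT \<eta>|lborel. of_real ((cmod (ft g \<eta>))\<^sup>2 * std_normal_density (inverse (real (Suc n)) * \<eta>)) * cis (\<eta> * x))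
      \<longlonglongrightarrow> corr (\<lambda>_. 1) g x * of_real (sqrt (2 * pi))"
proof -
  define A where "A = corr (\<lambda>_. 1) g"
  have [measurable]: "A \<in> borel_measurable borel"
    using borel_measurable_integrable[OF corr_integrable_L1[OF g(1)]] by (simp add: A_def)
  have "(\<lambda>n. LINT z|lborel. A (x + inverse (real (Suc n)) * z) * of_real (exp (- z\<^sup>2 / 2)))
     \<longlonglongrightarrow> (LINT z|lborel. A x * of_real (exp (- z\<^sup>2 / 2)))"
  proof (rule integral_dominated_convergence[where w = "\<lambda>z. (L2norm g)\<^sup>2 * exp (- z\<^sup>2 / 2)"])
    show "integrable lborel (\<lambda>z. (L2norm g)\<^sup>2 * exp (- z\<^sup>2 / 2))"
      using gaussian_integral_exp(1) by simp
    show "AE z in lborel. (\<lambda>n. A (x + inverse (real (Suc n)) * z) * of_real (exp (- z\<^sup>2 / 2))) \<longlonglongrightarrow> A x * of_real (exp (- z\<^sup>2 / 2))"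
    proof (intro AE_I2 tendsto_mult tendsto_const)
      fix z
      have "(\<lambda>n. x + inverse (real (Suc n)) * z) \<longlonglongrightarrow> x + 0 * z"
        by (intro tendsto_intros LIMSEQ_inverse_real_of_nat)
      then show "(\<lambda>n. A (x + inverse (real (Suc n)) * z)) \<longlonglongrightarrow> A x"
        unfolding A_def by (intro corr_continuous[OF g]) simp
    qed
    show "AE z in lborel. norm (A (x + inverse (real (Suc n)) * z) * of_real (exp (- z\<^sup>2 / 2))) \<le> (L2norm g)\<^sup>2 * exp (- z\<^sup>2 / 2)" for n
      using corr_bounded[OF g(2)] by (intro AE_I2) (simp add: norm_mult A_def mult_right_mono)
  qed simp_all
  also have "(LINT z|lborel. A x * of_real (exp (- z\<^sup>2 / 2))) = A x * of_real (sqrt (2 * pi))"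
    by (simp only: integral_mult_right_zero integral_complex_of_real gaussian_integral_exp(2))
  finally show ?thesis
    using gaussian_mean_of_ft_square[OF g(1), of "inverse (real (Suc _))" x] by (simp only: A_def inverse_positive_iff_positive of_nat_0_less_iff zero_less_Suc)
qed

text \<open>
  Remove the Gaussian damping. At \<open>x = 0\<close> Fatou's lemma yields the integrability of \<open>\<bar>ft g\<bar>\<^sup>2\<close>, which
  then serves as the dominating function for every \<open>x\<close>. The case \<open>x = 0\<close> of the formula
  is the isometry, up to the factor \<open>2 * pi\<close>.
\<close>
theorem Plancherel:
  assumes g: "integrable lborel g" "sqint g"
  shows "sqint (ft g)"
    and "corr (\<lambda>\<eta>. cis (\<eta> * x)) (ft g) 0 = 2 * pi * corr (\<lambda>_. 1) g x"
proof -
  have [measurable]: "g \<in> borel_measurable borel" using borel_measurable_integrable[OF g(1)] by simp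
  let ?\<phi> = "\<lambda>n \<eta>. std_normal_density (inverse (real (Suc n)) * \<eta>)"
  let ?I = "\<lambda>n x. LINT \<eta>|lborel. of_real ((cmod (ft g \<eta>))\<^sup>2 * ?\<phi> n \<eta>) * cis (\<eta> * x)"
  have \<phi>lim: "(\<lambda>n. ?\<phi> n \<eta>) \<longlonglongrightarrow> 1 / sqrt (2 * pi)" for \<eta>
  proof -
    have "(\<lambda>n. ?\<phi> n \<eta>) \<longlonglongrightarrow> 1 / sqrt (2 * pi) * exp (- (0 * \<eta>)\<^sup>2 / 2)"
      unfolding std_normal_density_def by (intro tendsto_intros LIMSEQ_inverse_real_of_nat) simp_all
    then show ?thesis by simp
  qed
  have \<phi>b: "0 \<le> ?\<phi> n \<eta>" "?\<phi> n \<eta> \<le> 1 / sqrt (2 * pi)" for n \<eta>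
    by (simp_all add: std_normal_density_def divide_right_mono)
  have ftb: "cmod (ft g \<eta>) \<le> (LINT t|lborel. cmod (g t))" for \<eta>
  proof -
    have "cmod (ft g \<eta>) \<le> (LINT t|lborel. cmod (g t * cis (- (\<eta> * t))))"
      unfolding ft_def by (rule integral_norm_bound)
    then show ?thesis by (simp add: norm_mult)
  qed
  have int_n: "integrable lborel (\<lambda>\<eta>. (cmod (ft g \<eta>))\<^sup>2 * ?\<phi> n \<eta>)" for n
  proof (rule Bochner_Integration.integrable_bound)
    show "integrable lborel (\<lambda>\<eta>. (LINT t|lborel. cmod (g t))\<^sup>2 * ?\<phi> n \<eta>)"
      using integrable_std_normal_scaled[of "inverse (real (Suc n))"] by simp
    show "AE \<eta> in lborel. norm ((cmod (ft g \<eta>))\<^sup>2 * ?\<phi> n \<eta>) \<le> norm ((LINT t|lborel. cmod (g t))\<^sup>2 * ?\<phi> n \<eta>)"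
      using ftb \<phi>b(1) by (intro AE_I2) (auto simp: abs_mult intro!: mult_mono power_mono)
  qed simp
  have lim: "(\<lambda>n. ?I n x) \<longlonglongrightarrow> corr (\<lambda>_. 1) g x * of_real (sqrt (2 * pi))" for x
    by (rule gaussian_mean_tendsto[OF g])
  have int: "integrable lborel (\<lambda>\<eta>. (cmod (ft g \<eta>))\<^sup>2)"
  proof (rule integrableI_bounded)
    have I0: "?I n 0 = of_real (LINT \<eta>|lborel. (cmod (ft g \<eta>))\<^sup>2 * ?\<phi> n \<eta>)" for n
      by (simp del: of_real_mult)
    have "(\<lambda>n. Re (?I n 0)) \<longlonglongrightarrow> Re (corr (\<lambda>_. 1) g 0 * of_real (sqrt (2 * pi)))"
      by (rule tendsto_Re[OF lim])
    then have l0: "(\<lambda>n. LINT \<eta>|lborel. (cmod (ft g \<eta>))\<^sup>2 * ?\<phi> n \<eta>) \<longlonglongrightarrow> Re (corr (\<lambda>_. 1) g 0 * of_real (sqrt (2 * pi)))"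
      unfolding I0 by simp
    have nn: "(\<integral>\<^sup>+\<eta>. ennreal ((cmod (ft g \<eta>))\<^sup>2 * ?\<phi> n \<eta>) \<partial>lborel) = ennreal (LINT \<eta>|lborel. (cmod (ft g \<eta>))\<^sup>2 * ?\<phi> n \<eta>)" for n
      using int_n[of n] \<phi>b(1) by (intro nn_integral_eq_integral) auto
    have "(\<integral>\<^sup>+\<eta>. ennreal ((cmod (ft g \<eta>))\<^sup>2 * (1 / sqrt (2 * pi))) \<partial>lborel)
        = (\<integral>\<^sup>+\<eta>. liminf (\<lambda>n. ennreal ((cmod (ft g \<eta>))\<^sup>2 * ?\<phi> n \<eta>)) \<partial>lborel)"
    proof (rule nn_integral_cong)
      fix \<eta>
      have "(\<lambda>n. ennreal ((cmod (ft g \<eta>))\<^sup>2 * ?\<phi> n \<eta>)) \<longlonglongrightarrow> ennreal ((cmod (ft g \<eta>))\<^sup>2 * (1 / sqrt (2 * pi)))"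
        by (intro tendsto_ennrealI tendsto_mult tendsto_const \<phi>lim)
      then show "ennreal ((cmod (ft g \<eta>))\<^sup>2 * (1 / sqrt (2 * pi))) = liminf (\<lambda>n. ennreal ((cmod (ft g \<eta>))\<^sup>2 * ?\<phi> n \<eta>))"
        by (metis lim_imp_Liminf trivial_limit_sequentially)
    qed
    also have "\<dots> \<le> liminf (\<lambda>n. \<integral>\<^sup>+\<eta>. ennreal ((cmod (ft g \<eta>))\<^sup>2 * ?\<phi> n \<eta>) \<partial>lborel)"
      by (rule nn_integral_liminf) measurable
    also have "\<dots> = ennreal (Re (corr (\<lambda>_. 1) g 0 * of_real (sqrt (2 * pi))))"
      unfolding nn by (intro lim_imp_Liminf tendsto_ennrealI l0) simp
    also have "\<dots> < \<infinity>" by simp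
    finally have fin: "(\<integral>\<^sup>+\<eta>. ennreal ((cmod (ft g \<eta>))\<^sup>2 * (1 / sqrt (2 * pi))) \<partial>lborel) < \<infinity>" .
    have "(\<integral>\<^sup>+\<eta>. ennreal ((cmod (ft g \<eta>))\<^sup>2) \<partial>lborel) = (\<integral>\<^sup>+\<eta>. ennreal (sqrt (2 * pi)) * ennreal ((cmod (ft g \<eta>))\<^sup>2 * (1 / sqrt (2 * pi))) \<partial>lborel)"
      by (intro nn_integral_cong) (simp flip: ennreal_mult)
    also have "\<dots> = ennreal (sqrt (2 * pi)) * (\<integral>\<^sup>+\<eta>. ennreal ((cmod (ft g \<eta>))\<^sup>2 * (1 / sqrt (2 * pi))) \<partial>lborel)"
      by (rule nn_integral_cmult) measurable
    also have "\<dots> < \<infinity>" using fin by (simp add: ennreal_mult_less_top)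
    finally show "(\<integral>\<^sup>+\<eta>. ennreal (norm ((cmod (ft g \<eta>))\<^sup>2)) \<partial>lborel) < \<infinity>" by simp
  qed simp
  show sq: "sqint (ft g)" by (simp add: sqint_def int)
  have "(\<lambda>n. ?I n x) \<longlonglongrightarrow> (LINT \<eta>|lborel. of_real ((cmod (ft g \<eta>))\<^sup>2 * (1 / sqrt (2 * pi))) * cis (\<eta> * x))"
  proof (rule integral_dominated_convergence[where w = "\<lambda>\<eta>. (cmod (ft g \<eta>))\<^sup>2 * (1 / sqrt (2 * pi))"])
    show "integrable lborel (\<lambda>\<eta>. (cmod (ft g \<eta>))\<^sup>2 * (1 / sqrt (2 * pi)))" using int by simp
    show "AE \<eta> in lborel. (\<lambda>n. of_real ((cmod (ft g \<eta>))\<^sup>2 * ?\<phi> n \<eta>) * cis (\<eta> * x)) \<longlonglongrightarrow>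
        of_real ((cmod (ft g \<eta>))\<^sup>2 * (1 / sqrt (2 * pi))) * cis (\<eta> * x)"
      by (intro AE_I2 tendsto_mult tendsto_of_real tendsto_const \<phi>lim)
    show "AE \<eta> in lborel. norm (of_real ((cmod (ft g \<eta>))\<^sup>2 * ?\<phi> n \<eta>) * cis (\<eta> * x)) \<le> (cmod (ft g \<eta>))\<^sup>2 * (1 / sqrt (2 * pi))" for n
    proof (intro AE_I2)
      fix \<eta>
      have "norm (of_real ((cmod (ft g \<eta>))\<^sup>2 * ?\<phi> n \<eta>) * cis (\<eta> * x)) = (cmod (ft g \<eta>))\<^sup>2 * ?\<phi> n \<eta>"
        using \<phi>b(1)[of n \<eta>] by (simp only: norm_mult norm_cis norm_of_real abs_mult abs_power2 abs_of_nonneg mult_1_right)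
      then show "norm (of_real ((cmod (ft g \<eta>))\<^sup>2 * ?\<phi> n \<eta>) * cis (\<eta> * x)) \<le> (cmod (ft g \<eta>))\<^sup>2 * (1 / sqrt (2 * pi))"
        using mult_left_mono[OF \<phi>b(2)[of n \<eta>], of "(cmod (ft g \<eta>))\<^sup>2"] by simp
    qed
  qed measurable
  then have eq: "(LINT \<eta>|lborel. of_real ((cmod (ft g \<eta>))\<^sup>2 * (1 / sqrt (2 * pi))) * cis (\<eta> * x)) = corr (\<lambda>_. 1) g x * of_real (sqrt (2 * pi))"
    using lim[of x] by (rule LIMSEQ_unique)
  have "corr (\<lambda>\<eta>. cis (\<eta> * x)) (ft g) 0 = (LINT \<eta>|lborel. of_real (sqrt (2 * pi)) * (of_real ((cmod (ft g \<eta>))\<^sup>2 * (1 / sqrt (2 * pi))) * cis (\<eta> * x)))"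
    unfolding corr_def
  proof (rule Bochner_Integration.integral_cong[OF refl])
    fix \<eta>
    have "ft g (\<eta> + 0) * cnj (ft g \<eta>) = of_real (sqrt (2 * pi)) * of_real ((cmod (ft g \<eta>))\<^sup>2 * (1 / sqrt (2 * pi)))"
      by (simp add: complex_norm_square[symmetric])
    then show "ft g (\<eta> + 0) * cnj (ft g \<eta>) * cis (\<eta> * x) = of_real (sqrt (2 * pi)) * (of_real ((cmod (ft g \<eta>))\<^sup>2 * (1 / sqrt (2 * pi))) * cis (\<eta> * x))"
      by simp
  qed
  also have "\<dots> = of_real (sqrt (2 * pi)) * (corr (\<lambda>_. 1) g x * of_real (sqrt (2 * pi)))"
    by (simp only: integral_mult_right_zero eq)
  also have "\<dots> = of_real (sqrt (2 * pi) * sqrt (2 * pi)) * corr (\<lambda>_. 1) g x"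
    by (simp only: of_real_mult ac_simps)
  finally show "corr (\<lambda>\<eta>. cis (\<eta> * x)) (ft g) 0 = 2 * pi * corr (\<lambda>_. 1) g x" by simp
qed

section \<open>Completeness of L2 and Borel versions\<close>

lemma L2norm_le:
  assumes "sqint g" "f \<in> borel_measurable borel" "\<And>t. cmod (f t) \<le> cmod (g t)"
  shows "L2norm f \<le> L2norm g"
  unfolding L2norm_def
  using sqint_integrable[OF sqint_bound[OF assms]] sqint_integrable[OF assms(1)]
  by (intro real_sqrt_le_mono integral_mono) (auto intro!: power_mono assms(3))

lemma nn_integral_sqint: "sqint f \<Longrightarrow> (\<integral>\<^sup>+t. ennreal ((cmod (f t))\<^sup>2) \<partial>lborel) = ennreal ((L2norm f)\<^sup>2)"
  using nn_integral_eq_integral[OF sqint_integrable] by (simp add: L2norm_power2)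

text \<open>
  The increments are summable almost everywhere, since their squares, even weighted by \<open>2 ^ n\<close>, have a
  finite total integral.
\<close>
lemma rapidly_Cauchy_converges_AE:
  assumes F: "\<And>n::nat. sqint (F n)"
    and step: "\<And>n. L2norm (\<lambda>t. F (Suc n) t - F n t) \<le> (1/2) ^ n"
  shows "AE t in lborel. convergent (\<lambda>n. F n t)"
proof -
  note [measurable] = sqint_measurable[OF F]
  let ?a = "\<lambda>n t. cmod (F (Suc n) t - F n t)"
  have "(\<integral>\<^sup>+t. (\<Sum>n. ennreal (2 ^ n * (?a n t)\<^sup>2)) \<partial>lborel) = (\<Sum>n. \<integral>\<^sup>+t. ennreal (2 ^ n * (?a n t)\<^sup>2) \<partial>lborel)"
    by (rule nn_integral_suminf) measurable
  also have "\<dots> \<le> (\<Sum>n. ennreal ((1/2) ^ n))"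
  proof (rule suminf_le)
    fix n
    have "(\<integral>\<^sup>+t. ennreal (2 ^ n * (?a n t)\<^sup>2) \<partial>lborel) = ennreal (2 ^ n) * (\<integral>\<^sup>+t. ennreal ((?a n t)\<^sup>2) \<partial>lborel)"
      by (subst nn_integral_cmult[symmetric]) (simp_all add: ennreal_mult)
    also have "\<dots> = ennreal (2 ^ n * (L2norm (\<lambda>t. F (Suc n) t - F n t))\<^sup>2)"
      using nn_integral_sqint[OF sqint_diff[OF F[of "Suc n"] F[of n]]] by (simp add: ennreal_mult)
    also have "\<dots> \<le> ennreal (2 ^ n * ((1/2) ^ n)\<^sup>2)"
      by (intro ennreal_leI mult_left_mono power_mono step L2norm_nonneg) simp
    also have "2 ^ n * ((1/2) ^ n)\<^sup>2 = (1/2::real) ^ n"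
      by (simp add: power2_eq_square power_divide)
    finally show "(\<integral>\<^sup>+t. ennreal (2 ^ n * (?a n t)\<^sup>2) \<partial>lborel) \<le> ennreal ((1/2) ^ n)" .
  qed simp_all
  also have "\<dots> = ennreal (\<Sum>n. (1/2) ^ n)"
    by (intro suminf_ennreal2) (simp_all add: summable_geometric)
  also have "\<dots> < \<infinity>" by simp
  finally have "AE t in lborel. (\<Sum>n. ennreal (2 ^ n * (?a n t)\<^sup>2)) \<noteq> \<infinity>"
    by (intro nn_integral_PInf_AE) auto
  then show ?thesis
  proof (rule AE_mp, intro AE_I2 impI)
    fix t assume "(\<Sum>n. ennreal (2 ^ n * (?a n t)\<^sup>2)) \<noteq> \<infinity>"
    then have s: "summable (\<lambda>n. 2 ^ n * (?a n t)\<^sup>2)"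
      by (intro summable_suminf_not_top) auto
    have "summable (\<lambda>n. (1/2) ^ n + 2 ^ n * (?a n t)\<^sup>2)"
      using s by (intro summable_add summable_geometric) auto
    then have "summable (\<lambda>n. F (Suc n) t - F n t)"
    proof (rule summable_comparison_test'[where N = 0])
      fix n
      \<comment> \<open>Arithmetic-geometric mean inequality: the increment is dominated by a geometric term plus its weighted square.\<close>
      have "2 ^ n * ((1/2) ^ n - ?a n t)\<^sup>2 \<ge> 0" by simp
      then have "2 * ?a n t \<le> (1/2) ^ n + 2 ^ n * (?a n t)\<^sup>2"
        by (simp add: power2_eq_square algebra_simps power_divide)
      then show "norm (F (Suc n) t - F n t) \<le> (1/2) ^ n + 2 ^ n * (?a n t)\<^sup>2"
        using norm_ge_zero[of "F (Suc n) t - F n t"] by linarith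
    qed
    then have "summable (\<lambda>n. F (Suc n) t - F n t)" .
    then have "(\<lambda>n. \<Sum>i<n. F (Suc i) t - F i t) \<longlonglongrightarrow> (\<Sum>i. F (Suc i) t - F i t)"
      by (rule summable_LIMSEQ)
    then have "(\<lambda>n. F n t - F 0 t) \<longlonglongrightarrow> (\<Sum>i. F (Suc i) t - F i t)"
      by (simp only: sum_lessThan_telescope[of "\<lambda>n. F n t"])
    then have "(\<lambda>n. F n t - F 0 t + F 0 t) \<longlonglongrightarrow> (\<Sum>i. F (Suc i) t - F i t) + F 0 t"
      by (intro tendsto_add tendsto_const)
    then show "convergent (\<lambda>n. F n t)" by (auto simp: convergent_def)
  qed
qed

text \<open>
  The limit is the almost everywhere limit along a rapidly convergent subsequence, and Fatou's lemma
  transfers the Cauchy bound to it.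
\<close>
lemma L2_complete:
  assumes F: "\<And>n::nat. sqint (F n)"
    and cauchy: "\<And>m n. n \<le> m \<Longrightarrow> L2norm (\<lambda>t. F m t - F n t) \<le> e n" and e: "e \<longlonglongrightarrow> 0"
  shows "\<exists>w. sqint w \<and> (\<lambda>n. L2norm (\<lambda>t. F n t - w t)) \<longlonglongrightarrow> 0"
proof -
  have "\<exists>N. \<forall>m\<ge>N. e m \<le> (1/2) ^ k" for k
    using LIMSEQ_D[OF e, of "(1/2) ^ k"] by (fastforce simp: abs_if split: if_splits)
  then obtain N where N: "\<And>k m. m \<ge> N k \<Longrightarrow> e m \<le> (1/2) ^ k" by metis
  \<comment> \<open>Summing the thresholds makes the subsequence monotone while staying above each of them.\<close>
  define R where "R k = k + (\<Sum>i\<le>k. N i)" for k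
  have RN: "R k \<ge> N k" for k
    unfolding R_def using member_le_sum[of k "{..k}" N] by simp
  have Rk: "R k \<ge> k" for k by (simp add: R_def)
  have RS: "R k \<le> R (Suc k)" for k by (simp add: R_def)
  note [measurable] = sqint_measurable[OF F]
  \<comment> \<open>The operator \<open>lim\<close> is total and yields a Borel function; the sequence converges to it off a null set.\<close>
  define w where "w t = lim (\<lambda>k. F (R k) t)" for t
  have [measurable]: "w \<in> borel_measurable borel"
    unfolding w_def[abs_def] by (rule borel_measurable_lim_metric) simp
  have conv: "AE t in lborel. (\<lambda>k. F (R k) t) \<longlonglongrightarrow> w t"
  proof -
    have "AE t in lborel. convergent (\<lambda>k. F (R k) t)"
    proof (rule rapidly_Cauchy_converges_AE)
      fix k
      show "L2norm (\<lambda>t. F (R (Suc k)) t - F (R k) t) \<le> (1/2) ^ k"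
        using cauchy[OF RS[of k]] N[OF RN[of k]] by linarith
    qed (rule F)
    then show ?thesis by (rule AE_mp) (auto simp: w_def convergent_LIMSEQ_iff)
  qed
  have fatou: "(\<integral>\<^sup>+t. ennreal ((cmod (F n t - w t))\<^sup>2) \<partial>lborel) \<le> ennreal ((e n)\<^sup>2)" for n
  proof -
    have "(\<integral>\<^sup>+t. ennreal ((cmod (F n t - w t))\<^sup>2) \<partial>lborel)
       = (\<integral>\<^sup>+t. liminf (\<lambda>k. ennreal ((cmod (F (R (n + k)) t - F n t))\<^sup>2)) \<partial>lborel)"
    proof (rule nn_integral_cong_AE, rule AE_mp[OF conv], intro AE_I2 impI)
      fix t assume "(\<lambda>k. F (R k) t) \<longlonglongrightarrow> w t"
      then have "(\<lambda>k. F (R (n + k)) t) \<longlonglongrightarrow> w t"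
        using LIMSEQ_ignore_initial_segment[of "\<lambda>k. F (R k) t" "w t" n] by (simp add: add.commute)
      then have "(\<lambda>k. ennreal ((cmod (F (R (n + k)) t - F n t))\<^sup>2)) \<longlonglongrightarrow> ennreal ((cmod (w t - F n t))\<^sup>2)"
        by (intro tendsto_ennrealI tendsto_intros)
      then show "ennreal ((cmod (F n t - w t))\<^sup>2) = liminf (\<lambda>k. ennreal ((cmod (F (R (n + k)) t - F n t))\<^sup>2))"
        by (subst lim_imp_Liminf) (simp_all add: norm_minus_commute)
    qed
    also have "\<dots> \<le> liminf (\<lambda>k. \<integral>\<^sup>+t. ennreal ((cmod (F (R (n + k)) t - F n t))\<^sup>2) \<partial>lborel)"
      by (rule nn_integral_liminf) measurable
    also have "\<dots> \<le> ennreal ((e n)\<^sup>2)"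
    proof -
      have "(\<integral>\<^sup>+t. ennreal ((cmod (F (R (n + k)) t - F n t))\<^sup>2) \<partial>lborel) \<le> ennreal ((e n)\<^sup>2)" for k
      proof -
        have "n \<le> R (n + k)" using Rk[of "n + k"] by simp
        from power_mono[OF cauchy[OF this] L2norm_nonneg, of 2] show ?thesis
          unfolding nn_integral_sqint[OF sqint_diff[OF F F]] by (rule ennreal_leI)
      qed
      then have "liminf (\<lambda>k. \<integral>\<^sup>+t. ennreal ((cmod (F (R (n + k)) t - F n t))\<^sup>2) \<partial>lborel) \<le> liminf (\<lambda>k::nat. ennreal ((e n)\<^sup>2))"
        by (intro Liminf_mono always_eventually allI)
      then show ?thesis by (simp add: Liminf_const)
    qed
    finally show ?thesis .
  qed
  have d: "sqint (\<lambda>t. F n t - w t)" for n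
    unfolding sqint_def
  proof
    show "integrable lborel (\<lambda>t. (cmod (F n t - w t))\<^sup>2)"
      using order.strict_trans1[OF fatou[of n]] by (intro integrableI_bounded) (simp_all add: less_top)
  qed simp
  have w: "sqint w"
    using sqint_diff[OF F[of 0] d[of 0]] by simp
  have "L2norm (\<lambda>t. F n t - w t) \<le> e n" for n
  proof -
    have "e n \<ge> 0" using cauchy[of n n] L2norm_nonneg[of "\<lambda>t. F n t - F n t"] by simp
    moreover have "(L2norm (\<lambda>t. F n t - w t))\<^sup>2 \<le> (e n)\<^sup>2"
      using fatou[of n] unfolding nn_integral_sqint[OF d] by simp
    ultimately show ?thesis using power2_le_imp_le by blast
  qed
  then have "(\<lambda>n. L2norm (\<lambda>t. F n t - w t)) \<longlonglongrightarrow> 0"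
    by (intro tendsto_sandwich[OF _ _ tendsto_const[of 0] e]) (simp_all add: L2norm_nonneg)
  with w show ?thesis by blast
qed

lemma ex_borel_version:
  assumes "u \<in> borel_measurable lebesgue"
  shows "\<exists>u'. u' \<in> borel_measurable borel \<and> (AE t in lebesgue. u t = (u' t :: complex))"
proof -
  have "(\<lambda>t. Re (u t)) \<in> borel_measurable lebesgue" "(\<lambda>t. Im (u t)) \<in> borel_measurable lebesgue"
    using assms by simp_all
  from this[THEN completion_ex_borel_measurable_real] obtain r i
    where r: "r \<in> borel_measurable lborel" "AE t in lborel. Re (u t) = r t"
      and i: "i \<in> borel_measurable lborel" "AE t in lborel. Im (u t) = i t" by blast
  have "AE t in lborel. u t = Complex (r t) (i t)"
    using r(2) i(2) by eventually_elim (simp add: complex_eq_iff)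
  moreover have "(\<lambda>t. Complex (r t) (i t)) \<in> borel_measurable borel"
    using r(1) i(1) unfolding Complex_eq by simp
  ultimately show ?thesis by (auto intro: AE_completion)
qed

lemma borel_measurable_imp_lebesgue: "f \<in> borel_measurable borel \<Longrightarrow> f \<in> borel_measurable lebesgue"
  by (rule measurable_completion) simp

lemma L2_borel_version:
  assumes "u \<in> L2"
  shows "\<exists>u'. sqint u' \<and> (AE t in lebesgue. u t = u' t)"
proof -
  from assms have u: "u \<in> borel_measurable lebesgue" and ui: "integrable lebesgue (\<lambda>x. (cmod (u x))\<^sup>2)"
    by (simp_all add: L2_def)
  obtain u' where u': "u' \<in> borel_measurable borel" and eq: "AE t in lebesgue. u t = u' t"
    using ex_borel_version[OF u] by blast
  have "integrable lebesgue (\<lambda>x. (cmod (u' x))\<^sup>2)"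
    using ui by (rule integrable_cong_AE_imp)
      (use eq borel_measurable_imp_lebesgue[OF u'] in \<open>auto elim!: eventually_mono\<close>)
  then have "integrable lborel (\<lambda>x. (cmod (u' x))\<^sup>2)"
    using u' by (subst (asm) integrable_completion) simp_all
  then show ?thesis using u' eq by (auto simp: sqint_def)
qed

lemma L1_borel_version:
  assumes "u \<in> L1" "u' \<in> borel_measurable borel" "AE t in lebesgue. u t = u' t"
  shows "integrable lborel u'"
proof -
  have "integrable lebesgue u'"
    using assms(1) unfolding L1_def mem_Collect_eq
    by (rule integrable_cong_AE_imp) (use assms borel_measurable_imp_lebesgue[OF assms(2)] in \<open>auto elim!: eventually_mono\<close>)
  then show ?thesis using assms(2) by (subst (asm) integrable_completion) simp_all
qed

lemma sqint_imp_L2: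
  assumes f: "sqint f"
  shows "f \<in> L2"
proof -
  note [measurable] = sqint_measurable[OF f]
  have "integrable lebesgue (\<lambda>x. (cmod (f x))\<^sup>2)"
    using sqint_integrable[OF f] by (subst integrable_completion) simp_all
  then show ?thesis
    using borel_measurable_imp_lebesgue[OF sqint_measurable[OF f]] by (simp add: L2_def)
qed

lemma tendsto_L2_iff:
  assumes f: "\<And>n. sqint (f' n)" and u: "sqint u'"
    and "\<And>n. AE t in lebesgue. f n t = f' n t" "AE t in lebesgue. u t = u' t"
  shows "tendsto_L2 f u \<longleftrightarrow> (\<lambda>n. L2norm (\<lambda>t. f' n t - u' t)) \<longlonglongrightarrow> 0"
proof -
  have "(\<integral>\<^sup>+t. ennreal ((cmod (f n t - u t))\<^sup>2) \<partial>lebesgue) = ennreal ((L2norm (\<lambda>t. f' n t - u' t))\<^sup>2)" for n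
  proof -
    have "(\<integral>\<^sup>+t. ennreal ((cmod (f n t - u t))\<^sup>2) \<partial>lebesgue) = (\<integral>\<^sup>+t. ennreal ((cmod (f' n t - u' t))\<^sup>2) \<partial>lebesgue)"
      using assms(3)[of n] assms(4) by (intro nn_integral_cong_AE) (auto elim: eventually_elim2)
    then show ?thesis by (simp add: nn_integral_completion nn_integral_sqint[OF sqint_diff[OF f u]])
  qed
  then have "tendsto_L2 f u \<longleftrightarrow> (\<lambda>n. ennreal ((L2norm (\<lambda>t. f' n t - u' t))\<^sup>2)) \<longlonglongrightarrow> ennreal 0"
    by (simp add: tendsto_L2_def)
  also have "\<dots> \<longleftrightarrow> (\<lambda>n. (L2norm (\<lambda>t. f' n t - u' t))\<^sup>2) \<longlonglongrightarrow> 0"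
    by (rule tendsto_ennreal_iff) (simp_all)
  also have "\<dots> \<longleftrightarrow> (\<lambda>n. L2norm (\<lambda>t. f' n t - u' t)) \<longlonglongrightarrow> 0"
  proof
    assume "(\<lambda>n. (L2norm (\<lambda>t. f' n t - u' t))\<^sup>2) \<longlonglongrightarrow> 0"
    from tendsto_real_sqrt[OF this] show "(\<lambda>n. L2norm (\<lambda>t. f' n t - u' t)) \<longlonglongrightarrow> 0"
      by (simp add: L2norm_nonneg)
  next
    assume "(\<lambda>n. L2norm (\<lambda>t. f' n t - u' t)) \<longlonglongrightarrow> 0"
    from tendsto_power[OF this, of 2] show "(\<lambda>n. (L2norm (\<lambda>t. f' n t - u' t))\<^sup>2) \<longlonglongrightarrow> 0" by simp
  qed
  finally show ?thesis .
qed

section \<open>Phaseless fractional Fourier data as ambiguity function values\<close>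

definition chirp :: "real \<Rightarrow> (real \<Rightarrow> complex) \<Rightarrow> real \<Rightarrow> complex" where
  "chirp c f t = f t * cis (- (pi * t\<^sup>2 * c))"

text \<open>
  On integrable functions this is the fractional transform itself, written as chirp, Fourier transform
  and chirp; see \<open>frft_integral_eq_frft_ft\<close>.
\<close>
definition frft_ft :: "real \<Rightarrow> (real \<Rightarrow> complex) \<Rightarrow> real \<Rightarrow> complex" where
  "frft_ft \<alpha> f \<xi> = frft_const \<alpha> * cis (- (pi * \<xi>\<^sup>2 * cot \<alpha>)) * ft (chirp (cot \<alpha>) f) (2 * pi / sin \<alpha> * \<xi>)"

lemma frft_integral_eq_frft_ft:
  assumes [measurable]: "f' \<in> borel_measurable borel" and eq: "AE t in lebesgue. f t = f' t"
    and L1: "f \<in> L1"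
  shows "frft_integral \<alpha> f = frft_ft \<alpha> f'"
proof
  fix \<xi>
  have meas: "f \<in> borel_measurable lebesgue" using L1 by (simp add: L1_def borel_measurable_integrable)
  let ?g = "\<lambda>t. chirp (cot \<alpha>) f' t * cis (- (2 * pi / sin \<alpha> * \<xi> * t))"
  have gm: "?g \<in> borel_measurable borel" unfolding chirp_def by measurable
  have e: "exp (- \<i> * of_real r) = cis (- r)" for r by (simp add: cis_conv_exp)
  have e2: "exp (- 2 * \<i> * of_real (pi * t * \<xi> / sin \<alpha>)) = cis (- (2 * pi / sin \<alpha> * \<xi> * t))" for t
    by (simp add: cis_conv_exp field_simps)
  have cm: "(\<lambda>t. cis (h t)) \<in> borel_measurable lebesgue" if "h \<in> borel_measurable borel" for h :: "real \<Rightarrow> real"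
    using that by (intro borel_measurable_cis borel_measurable_imp_lebesgue[where 'a=real] measurable_completion) simp
  have "(LINT t|lebesgue. f t * exp (- \<i> * of_real (pi * t\<^sup>2 * cot \<alpha>)) * exp (- 2 * \<i> * of_real (pi * t * \<xi> / sin \<alpha>)))
      = (LINT t|lebesgue. ?g t)"
    unfolding e e2
  proof (rule integral_cong_AE)
    show "AE t in lebesgue. f t * cis (- (pi * t\<^sup>2 * cot \<alpha>)) * cis (- (2 * pi / sin \<alpha> * \<xi> * t)) = ?g t"
      using eq by eventually_elim (simp add: chirp_def)
    show "(\<lambda>t. f t * cis (- (pi * t\<^sup>2 * cot \<alpha>)) * cis (- (2 * pi / sin \<alpha> * \<xi> * t))) \<in> borel_measurable lebesgue"
      by (intro borel_measurable_times meas cm) simp_all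
  qed (rule borel_measurable_imp_lebesgue[OF gm])
  also have "\<dots> = (LINT t|lborel. ?g t)"
    using gm by (intro integral_completion) simp
  finally show "frft_integral \<alpha> f \<xi> = frft_ft \<alpha> f' \<xi>"
    unfolding frft_integral_def frft_ft_def ft_def e by simp
qed

lemma chirp_sqint: "sqint f \<Longrightarrow> sqint (chirp c f)"
  unfolding chirp_def by (rule sqint_bound[of f]) (auto simp: norm_mult sqint_def)

lemma chirp_integrable: "integrable lborel f \<Longrightarrow> integrable lborel (chirp c f)"
  unfolding chirp_def[abs_def] by (rule ft_integrable) simp_all

lemma cmod_frft_const: "sin \<alpha> \<noteq> 0 \<Longrightarrow> (cmod (frft_const \<alpha>))\<^sup>2 = 1 / \<bar>sin \<alpha>\<bar>"
  by (simp add: frft_const_def norm_divide norm_mult power_divide)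

text \<open>
  Plancherel's formula for the chirped function, after rescaling the frequency by \<open>2 * pi / sin \<alpha>\<close>. The
  outer chirp drops out of the modulus, and the inner one leaves the difference of two quadratic phases,
  which is affine in \<open>t\<close>.
\<close>
lemma frft_ft_corr:
  assumes f: "integrable lborel f" "sqint f" and s: "sin \<alpha> \<noteq> 0"
  shows "sqint (frft_ft \<alpha> f)"
    and "corr (\<lambda>\<xi>. cis (2 * pi / sin \<alpha> * \<xi> * x)) (frft_ft \<alpha> f) 0
       = corr (\<lambda>t. cis (- (pi * cot \<alpha> * (2 * t * x + x\<^sup>2)))) f x"
proof -
  let ?c = "2 * pi / sin \<alpha>"
  let ?g = "chirp (cot \<alpha>) f"
  note g = chirp_integrable[OF f(1), of "cot \<alpha>"] chirp_sqint[OF f(2), of "cot \<alpha>"]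
  note [measurable] = sqint_measurable[OF f(2)] sqint_measurable[OF g(2)]
  have c0: "?c \<noteq> 0" using s by simp
  have P: "sqint (ft ?g)" by (rule Plancherel(1)[OF g])
  have sq: "(cmod (frft_ft \<alpha> f \<xi>))\<^sup>2 = (1 / \<bar>sin \<alpha>\<bar>) * (cmod (ft ?g (0 + ?c * \<xi>)))\<^sup>2" for \<xi>
    unfolding frft_ft_def norm_mult norm_cis power_mult_distrib cmod_frft_const[OF s] by simp
  show "sqint (frft_ft \<alpha> f)"
    unfolding sqint_def
  proof
    show "frft_ft \<alpha> f \<in> borel_measurable borel" unfolding frft_ft_def[abs_def] by measurable
    show "integrable lborel (\<lambda>\<xi>. (cmod (frft_ft \<alpha> f \<xi>))\<^sup>2)"
      unfolding sq using lborel_integrable_real_affine[OF sqint_integrable[OF P] c0, of 0] by simp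
  qed
  have "corr (\<lambda>\<xi>. cis (?c * \<xi> * x)) (frft_ft \<alpha> f) 0
      = (LINT \<xi>|lborel. of_real (1 / \<bar>sin \<alpha>\<bar>) * (of_real ((cmod (ft ?g (0 + ?c * \<xi>)))\<^sup>2) * cis ((0 + ?c * \<xi>) * x)))"
    unfolding corr_def
  proof (rule Bochner_Integration.integral_cong[OF refl])
    fix \<xi>
    have "frft_ft \<alpha> f (\<xi> + 0) * cnj (frft_ft \<alpha> f \<xi>) = of_real ((cmod (frft_ft \<alpha> f \<xi>))\<^sup>2)"
      by (simp only: add_0_right complex_norm_square)
    then show "frft_ft \<alpha> f (\<xi> + 0) * cnj (frft_ft \<alpha> f \<xi>) * cis (?c * \<xi> * x)
        = of_real (1 / \<bar>sin \<alpha>\<bar>) * (of_real ((cmod (ft ?g (0 + ?c * \<xi>)))\<^sup>2) * cis ((0 + ?c * \<xi>) * x))"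
      unfolding sq by simp
  qed
  also have "\<dots> = of_real (1 / \<bar>sin \<alpha>\<bar>) * (LINT \<xi>|lborel. of_real ((cmod (ft ?g (0 + ?c * \<xi>)))\<^sup>2) * cis ((0 + ?c * \<xi>) * x))"
    by (rule integral_mult_right_zero)
  also have "(LINT \<xi>|lborel. of_real ((cmod (ft ?g (0 + ?c * \<xi>)))\<^sup>2) * cis ((0 + ?c * \<xi>) * x))
     = (1 / \<bar>?c\<bar>) *\<^sub>R (LINT \<eta>|lborel. of_real ((cmod (ft ?g \<eta>))\<^sup>2) * cis (\<eta> * x))"
    using lborel_integral_real_affine[OF c0, of "\<lambda>\<eta>. of_real ((cmod (ft ?g \<eta>))\<^sup>2) * cis (\<eta> * x)" 0] c0
    by simp
  also have "(LINT \<eta>|lborel. of_real ((cmod (ft ?g \<eta>))\<^sup>2) * cis (\<eta> * x)) = corr (\<lambda>\<eta>. cis (\<eta> * x)) (ft ?g) 0"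
    by (simp only: corr_def add_0_right complex_norm_square)
  also have "\<dots> = 2 * pi * corr (\<lambda>_. 1) ?g x"
    by (rule Plancherel(2)[OF g])
  also have "of_real (1 / \<bar>sin \<alpha>\<bar>) * ((1 / \<bar>?c\<bar>) *\<^sub>R (2 * pi * corr (\<lambda>_. 1) ?g x)) = corr (\<lambda>_. 1) ?g x"
    using s by (simp add: scaleR_conv_of_real abs_mult)
  also have "\<dots> = corr (\<lambda>t. cis (- (pi * cot \<alpha> * (2 * t * x + x\<^sup>2)))) f x"
    unfolding corr_def
  proof (rule Bochner_Integration.integral_cong[OF refl])
    fix t
    have "cis (- (pi * (t + x)\<^sup>2 * cot \<alpha>)) * cis (pi * t\<^sup>2 * cot \<alpha>) = cis (- (pi * cot \<alpha> * (2 * t * x + x\<^sup>2)))"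
      unfolding cis_mult by (rule arg_cong[of _ _ cis]) (simp add: power2_eq_square algebra_simps)
    then show "?g (t + x) * cnj (?g t) * 1 = f (t + x) * cnj (f t) * cis (- (pi * cot \<alpha> * (2 * t * x + x\<^sup>2)))"
      by (simp add: chirp_def cis_cnj mult.assoc mult.left_commute[of "cis _" "cnj _"])
  qed
  finally show "corr (\<lambda>\<xi>. cis (?c * \<xi> * x)) (frft_ft \<alpha> f) 0
       = corr (\<lambda>t. cis (- (pi * cot \<alpha> * (2 * t * x + x\<^sup>2)))) f x" .
qed

lemma L2norm_corr: "sqint f \<Longrightarrow> of_real ((L2norm f)\<^sup>2) = corr (\<lambda>_. 1) f 0"
  by (simp add: L2norm_power2 corr_def complex_norm_square[symmetric] del: of_real_power)

lemma L2norm_frft_ft: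
  assumes "integrable lborel f" "sqint f" "sin \<alpha> \<noteq> 0"
  shows "L2norm (frft_ft \<alpha> f) = L2norm f"
proof -
  have "complex_of_real ((L2norm (frft_ft \<alpha> f))\<^sup>2) = of_real ((L2norm f)\<^sup>2)"
    using frft_ft_corr(2)[OF assms, of 0] frft_ft_corr(1)[OF assms] assms(2)
    by (simp only: L2norm_corr) simp
  then have "(L2norm (frft_ft \<alpha> f))\<^sup>2 = (L2norm f)\<^sup>2" by (simp only: of_real_eq_iff)
  then show ?thesis using L2norm_nonneg by (simp add: power2_eq_iff_nonneg)
qed

lemma frft_ft_diff:
  assumes "integrable lborel f" "integrable lborel g"
  shows "frft_ft \<alpha> f \<xi> - frft_ft \<alpha> g \<xi> = frft_ft \<alpha> (\<lambda>t. f t - g t) \<xi>"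
proof -
  have D: "ft (chirp c (\<lambda>t. f t - g t)) \<eta> = ft (chirp c f) \<eta> - ft (chirp c g) \<eta>" for c \<eta>
  proof -
    have "integrable lborel (\<lambda>t. chirp c f t * cis (- (\<eta> * t)))" "integrable lborel (\<lambda>t. chirp c g t * cis (- (\<eta> * t)))"
      using assms by (auto intro!: ft_integrable chirp_integrable)
    then show ?thesis
      unfolding ft_def by (subst Bochner_Integration.integral_diff[symmetric]) (simp_all add: chirp_def algebra_simps)
  qed
  show ?thesis by (simp only: frft_ft_def D right_diff_distrib)
qed

lemma sqint_restrict_integrable:
  assumes u: "sqint u"
  shows "integrable lborel (\<lambda>t. if \<bar>t\<bar> \<le> r then u t else 0)"
proof (rule Bochner_Integration.integrable_bound)
  note [measurable] = sqint_measurable[OF u]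
  show "integrable lborel (\<lambda>t. indicator {-r..r} t + (cmod (u t))\<^sup>2)"
    using sqint_integrable[OF u] by (intro Bochner_Integration.integrable_add) (simp_all add: integrable_indicator_iff emeasure_lborel_Icc_eq)
  show "AE t in lborel. norm (if \<bar>t\<bar> \<le> r then u t else 0) \<le> norm (indicator {-r..r} t + (cmod (u t))\<^sup>2)"
  proof (intro AE_I2)
    fix t
    have "0 \<le> (cmod (u t) - 1)\<^sup>2" by simp
    then have "2 * cmod (u t) \<le> 1 + (cmod (u t))\<^sup>2" by (simp add: power2_diff)
    then have "cmod (u t) \<le> 1 + (cmod (u t))\<^sup>2" using norm_ge_zero[of "u t"] by linarith
    then show "norm (if \<bar>t\<bar> \<le> r then u t else 0) \<le> norm (indicator {-r..r} t + (cmod (u t))\<^sup>2)"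
      by (auto simp: indicator_def)
  qed
next
  have [measurable]: "u \<in> borel_measurable borel" by (rule sqint_measurable[OF u])
  show "(\<lambda>t. if \<bar>t\<bar> \<le> r then u t else 0) \<in> borel_measurable lborel" by simp
qed

text \<open>
  The transforms of the restrictions of \<open>u\<close> to growing intervals form a Cauchy sequence because the
  transform is isometric on the integrable functions.
\<close>
lemma is_frft_exists:
  assumes u: "u \<in> L2" and s: "sin \<alpha> \<noteq> 0"
  shows "\<exists>w. is_frft \<alpha> u w"
proof -
  obtain u' where u': "sqint u'" and eq: "AE t in lebesgue. u t = u' t"
    using L2_borel_version[OF u] by blast
  note [measurable] = sqint_measurable[OF u']
  define f where "f n t = (if \<bar>t\<bar> \<le> real n then u' t else 0)" for n t
  have fi: "integrable lborel (f n)" for n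
    unfolding f_def[abs_def] by (rule sqint_restrict_integrable[OF u'])
  have fs: "sqint (f n)" for n
    unfolding f_def[abs_def] by (rule sqint_bound[OF u']) simp_all
  have "\<forall>\<^sub>F n in sequentially. \<bar>t\<bar> \<le> real n" for t
    by (rule eventually_mono[OF filterlim_at_top[THEN iffD1, OF filterlim_real_sequentially, rule_format, of "\<bar>t\<bar>"]])
  then have lim: "(\<lambda>n. L2norm (\<lambda>t. f n t - u' t)) \<longlonglongrightarrow> 0"
    unfolding f_def by (intro truncation_tendsto[OF u']) simp_all
  have cauchy: "L2norm (\<lambda>\<xi>. frft_ft \<alpha> (f m) \<xi> - frft_ft \<alpha> (f n) \<xi>) \<le> L2norm (\<lambda>t. f n t - u' t)" if "n \<le> m" for m n
  proof -
    have "L2norm (\<lambda>\<xi>. frft_ft \<alpha> (f m) \<xi> - frft_ft \<alpha> (f n) \<xi>) = L2norm (\<lambda>t. f m t - f n t)"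
      unfolding frft_ft_diff[OF fi fi] using L2norm_frft_ft[OF _ sqint_diff[OF fs fs] s] fi by simp
    also have "\<dots> \<le> L2norm (\<lambda>t. f n t - u' t)"
    proof (rule L2norm_le[OF sqint_diff[OF fs u']])
      show "(\<lambda>t. f m t - f n t) \<in> borel_measurable borel"
        using fs by (intro borel_measurable_diff) (simp_all add: sqint_measurable)
      fix t show "cmod (f m t - f n t) \<le> cmod (f n t - u' t)"
        using that by (auto simp: f_def)
    qed
    finally show ?thesis .
  qed
  obtain w where w: "sqint w" "(\<lambda>n. L2norm (\<lambda>\<xi>. frft_ft \<alpha> (f n) \<xi> - w \<xi>)) \<longlonglongrightarrow> 0"
    using L2_complete[OF frft_ft_corr(1)[OF fi fs s] cauchy lim] by blast
  have fL: "f n \<in> L1 \<inter> L2" for n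
    using sqint_imp_L2[OF fs] fi fs[of n] unfolding L1_def
    by (auto simp: sqint_def integrable_completion)
  have fint: "frft_integral \<alpha> (f n) = frft_ft \<alpha> (f n)" for n
    using fL[of n] by (intro frft_integral_eq_frft_ft sqint_measurable fs) auto
  have "tendsto_L2 f u"
    using lim by (subst tendsto_L2_iff[OF fs u' _ eq]) auto
  moreover have "tendsto_L2 (\<lambda>n. frft_integral \<alpha> (f n)) w"
    using w by (subst tendsto_L2_iff[of "\<lambda>n. frft_ft \<alpha> (f n)" w]) (auto simp: fint frft_ft_corr(1)[OF fi fs s])
  ultimately have "is_frft \<alpha> u w"
    unfolding is_frft_def using u sqint_imp_L2[OF w(1)] fL by blast
  then show ?thesis by blast
qed

text \<open>
  Both sides are continuous with respect to L2 convergence, so the identity passes from integrable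
  functions to the closure of the graph.
\<close>
lemma is_frft_corr:
  assumes w: "is_frft \<alpha> u w" and s: "sin \<alpha> \<noteq> 0"
    and u': "sqint u'" "AE t in lebesgue. u t = u' t"
    and w': "sqint w'" "AE t in lebesgue. w t = w' t"
  shows "corr (\<lambda>\<xi>. cis (2 * pi / sin \<alpha> * \<xi> * x)) w' 0 = corr (\<lambda>t. cis (- (pi * cot \<alpha> * (2 * t * x + x\<^sup>2)))) u' x"
proof -
  obtain f where f: "\<And>n::nat. f n \<in> L1 \<inter> L2" "tendsto_L2 f u" "tendsto_L2 (\<lambda>n. frft_integral \<alpha> (f n)) w"
    using w unfolding is_frft_def by blast
  have "\<forall>n. \<exists>g. sqint g \<and> (AE t in lebesgue. f n t = g t)"
    using f(1) L2_borel_version by blast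
  then obtain g where g: "\<And>n. sqint (g n)" "\<And>n. AE t in lebesgue. f n t = g n t" by metis
  have gi: "integrable lborel (g n)" for n
    using f(1)[of n] by (intro L1_borel_version[OF _ sqint_measurable[OF g(1)] g(2)]) simp
  have fg: "frft_integral \<alpha> (f n) = frft_ft \<alpha> (g n)" for n
    using f(1)[of n] by (intro frft_integral_eq_frft_ft[OF sqint_measurable[OF g(1)] g(2)]) simp
  have "(\<lambda>n. L2norm (\<lambda>t. g n t - u' t)) \<longlonglongrightarrow> 0"
    using f(2) by (simp only: tendsto_L2_iff[of g u' f u, OF g(1) u'(1) g(2) u'(2)])
  then have l1: "(\<lambda>n. corr (\<lambda>t. cis (- (pi * cot \<alpha> * (2 * t * x + x\<^sup>2)))) (g n) x) \<longlonglongrightarrow> corr (\<lambda>t. cis (- (pi * cot \<alpha> * (2 * t * x + x\<^sup>2)))) u' x"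
    by (intro corr_limit g u') simp_all
  have "(\<lambda>n. L2norm (\<lambda>t. frft_ft \<alpha> (g n) t - w' t)) \<longlonglongrightarrow> 0"
    using f(3) tendsto_L2_iff[of "\<lambda>n. frft_ft \<alpha> (g n)" w' "\<lambda>n. frft_integral \<alpha> (f n)" w, OF frft_ft_corr(1)[OF gi g(1) s] w'(1) _ w'(2)]
    by (simp add: fg)
  then have "(\<lambda>n. corr (\<lambda>\<xi>. cis (2 * pi / sin \<alpha> * \<xi> * x)) (frft_ft \<alpha> (g n)) 0) \<longlonglongrightarrow> corr (\<lambda>\<xi>. cis (2 * pi / sin \<alpha> * \<xi> * x)) w' 0"
    by (intro corr_limit frft_ft_corr(1)[OF gi g(1) s] w') simp_all
  with l1 show ?thesis
    unfolding frft_ft_corr(2)[OF gi g(1) s] by (rule LIMSEQ_unique[rotated])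
qed

lemma is_frft_frft:
  assumes u: "u \<in> L2" and s: "sin \<alpha> \<noteq> 0"
  shows "is_frft \<alpha> u (frft \<alpha> u)"
proof -
  have "\<not> (\<exists>k::int. \<alpha> = 2 * of_int k * pi)" "\<not> (\<exists>k::int. \<alpha> = (2 * of_int k + 1) * pi)"
    using s sin_zero_iff_int2[of \<alpha>] by (metis of_int_mult of_int_numeral, metis of_int_1 of_int_add of_int_mult of_int_numeral)
  then have "frft \<alpha> u = (SOME w. is_frft \<alpha> u w)" unfolding frft_def by simp
  then show ?thesis using someI_ex[OF is_frft_exists[OF u s]] by simp
qed

text \<open>
  As a function of \<open>x\<close> and of the frequency, the Fourier transform in \<open>t\<close> of this difference is, up to
  unimodular factors, the difference of the ambiguity functions of \<open>u\<close> and \<open>v\<close>.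
\<close>
definition shift_product_diff :: "(real \<Rightarrow> complex) \<Rightarrow> (real \<Rightarrow> complex) \<Rightarrow> real \<Rightarrow> real \<Rightarrow> complex" where
  "shift_product_diff u v x t = u (t + x) * cnj (u t) - v (t + x) * cnj (v t)"

lemma shift_product_diff_integrable:
  assumes "sqint u" "sqint v"
  shows "integrable lborel (shift_product_diff u v x)"
  unfolding shift_product_diff_def[abs_def]
  using assms by (intro Bochner_Integration.integrable_diff sqint_mult_integrable sqint_shift sqint_cnj)

text \<open>
  Equality of the moduli at one angle gives equality of the spectral densities, hence of the weighted
  correlations; removing the phase \<open>cis (- (pi * cot \<alpha> * x\<^sup>2))\<close>, which does not depend on \<open>t\<close>, leaves a zero of a
  Fourier transform.
\<close>
lemma ft_shift_product_diff_eq_0: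
  assumes u: "u \<in> L2" "sqint u'" "AE t in lebesgue. u t = u' t"
    and v: "v \<in> L2" "sqint v'" "AE t in lebesgue. v t = v' t"
    and s: "sin \<alpha> \<noteq> 0" and eq: "AE \<xi> in lebesgue. cmod (frft \<alpha> v \<xi>) = cmod (frft \<alpha> u \<xi>)"
  shows "ft (shift_product_diff u' v' x) (2 * pi * x * cot \<alpha>) = 0"
proof -
  have fu: "is_frft \<alpha> u (frft \<alpha> u)" and fv: "is_frft \<alpha> v (frft \<alpha> v)"
    using u v s by (auto intro: is_frft_frft)
  then obtain U V where U: "sqint U" "AE \<xi> in lebesgue. frft \<alpha> u \<xi> = U \<xi>"
    and V: "sqint V" "AE \<xi> in lebesgue. frft \<alpha> v \<xi> = V \<xi>"
    using L2_borel_version unfolding is_frft_def by meson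
  note [measurable] = sqint_measurable[OF U(1)] sqint_measurable[OF V(1)]
  have "AE \<xi> in lebesgue. cmod (V \<xi>) = cmod (U \<xi>)"
    using eq U(2) V(2) by eventually_elim simp
  then have ae: "AE \<xi> in lborel. cmod (V \<xi>) = cmod (U \<xi>)"
    by (simp add: AE_completion_iff)
  let ?e = "\<lambda>t. cis (- (pi * cot \<alpha> * (2 * t * x + x\<^sup>2)))"
  have "corr (\<lambda>\<xi>. cis (2 * pi / sin \<alpha> * \<xi> * x)) V 0 = corr (\<lambda>\<xi>. cis (2 * pi / sin \<alpha> * \<xi> * x)) U 0"
    unfolding corr_def
  proof (rule integral_cong_AE)
    show "AE \<xi> in lborel. V (\<xi> + 0) * cnj (V \<xi>) * cis (2 * pi / sin \<alpha> * \<xi> * x) = U (\<xi> + 0) * cnj (U \<xi>) * cis (2 * pi / sin \<alpha> * \<xi> * x)"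
      using ae by eventually_elim (simp add: complex_norm_square[symmetric])
  qed measurable
  then have "corr ?e u' x - corr ?e v' x = 0"
    using is_frft_corr[OF fu s u(2,3) U] is_frft_corr[OF fv s v(2,3) V] by simp
  moreover have "corr ?e u' x - corr ?e v' x = cis (- (pi * cot \<alpha> * x\<^sup>2)) * ft (shift_product_diff u' v' x) (2 * pi * x * cot \<alpha>)"
  proof -
    have "corr ?e u' x - corr ?e v' x = (LINT t|lborel. u' (t + x) * cnj (u' t) * ?e t - v' (t + x) * cnj (v' t) * ?e t)"
      unfolding corr_def by (subst Bochner_Integration.integral_diff) (auto intro!: corr_integrable u v)
    also have "\<dots> = (LINT t|lborel. cis (- (pi * cot \<alpha> * x\<^sup>2)) * (shift_product_diff u' v' x t * cis (- (2 * pi * x * cot \<alpha> * t))))"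
    proof (rule Bochner_Integration.integral_cong[OF refl])
      fix t
      have "?e t = cis (- (pi * cot \<alpha> * x\<^sup>2)) * cis (- (2 * pi * x * cot \<alpha> * t))"
        unfolding cis_mult by (rule arg_cong[of _ _ cis]) (simp add: algebra_simps)
      then show "u' (t + x) * cnj (u' t) * ?e t - v' (t + x) * cnj (v' t) * ?e t =
          cis (- (pi * cot \<alpha> * x\<^sup>2)) * (shift_product_diff u' v' x t * cis (- (2 * pi * x * cot \<alpha> * t)))"
        by (simp add: shift_product_diff_def algebra_simps)
    qed
    also have "\<dots> = cis (- (pi * cot \<alpha> * x\<^sup>2)) * ft (shift_product_diff u' v' x) (2 * pi * x * cot \<alpha>)"
      unfolding ft_def by (rule integral_mult_right_zero)
    finally show ?thesis .
  qed
  ultimately show ?thesis by simp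
qed

section \<open>Uniqueness of Fourier transforms\<close>

text \<open>
  The positive and the negative part have the same mass and the same transform. Normalised, they
  are probability densities with the same characteristic function, so Levy's theorem identifies them.
\<close>
lemma ft_unique_real:
  fixes r :: "real \<Rightarrow> real"
  assumes r: "integrable lborel r" and z: "\<And>\<eta>. ft (\<lambda>t. of_real (r t)) \<eta> = 0"
  shows "AE t in lborel. r t = 0"
proof -
  have [measurable]: "r \<in> borel_measurable borel" using borel_measurable_integrable[OF r] by simp
  define p where "p t = max (r t) 0" for t
  define q where "q t = max (- r t) 0" for t
  have p: "integrable lborel p" and q: "integrable lborel q"
    using r unfolding p_def[abs_def] q_def[abs_def] by auto
  have [measurable]: "p \<in> borel_measurable borel" "q \<in> borel_measurable borel"
    using borel_measurable_integrable[OF p] borel_measurable_integrable[OF q] by simp_all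
  have p0: "p t \<ge> 0" and q0: "q t \<ge> 0" and rpq: "r t = p t - q t" for t
    by (simp_all add: p_def q_def)
  have F: "(LINT t|lborel. of_real (p t) * cis (\<eta> * t)) = (LINT t|lborel. of_real (q t) * cis (\<eta> * t))" for \<eta>
  proof -
    have "integrable lborel (\<lambda>t. of_real (p t) * cis (\<eta> * t))" "integrable lborel (\<lambda>t. of_real (q t) * cis (\<eta> * t))"
      using p q by (auto intro!: ft_integrable)
    from Bochner_Integration.integral_diff[OF this] show ?thesis
      using z[of "- \<eta>"] by (simp add: ft_def rpq left_diff_distrib)
  qed
  define m where "m = (LINT t|lborel. p t)"
  have mq: "(LINT t|lborel. q t) = m"
    using F[of 0] by (simp add: m_def)
  have "m \<ge> 0" unfolding m_def by (rule integral_nonneg_AE) (simp add: p0)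
  show ?thesis
  proof (cases "m = 0")
    case True
    have "AE t in lborel. p t = 0"
      using True integral_nonneg_eq_0_iff_AE[OF p] by (simp add: p0 m_def)
    moreover have "AE t in lborel. q t = 0"
      using True mq integral_nonneg_eq_0_iff_AE[OF q] by (simp add: q0)
    ultimately show ?thesis by eventually_elim (simp add: rpq)
  next
    case False
    with \<open>m \<ge> 0\<close> have m: "m > 0" by simp
    have dist: "real_distribution (density lborel (\<lambda>t. ennreal (f t / m)))"
      if f: "integrable lborel f" "\<And>t. f t \<ge> 0" "(LINT t|lborel. f t) = m" for f
    proof -
      have [measurable]: "f \<in> borel_measurable borel" using borel_measurable_integrable[OF f(1)] by simp
      have "emeasure (density lborel (\<lambda>t. ennreal (f t / m))) UNIV = (\<integral>\<^sup>+t. ennreal (f t / m) \<partial>lborel)"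
        by (subst emeasure_density) simp_all
      also have "\<dots> = ennreal (LINT t|lborel. f t / m)"
        using f m by (intro nn_integral_eq_integral) auto
      also have "\<dots> = 1" using f(3) m by simp
      finally have "emeasure (density lborel (\<lambda>t. ennreal (f t / m))) UNIV = 1" .
      then show ?thesis
        by (intro real_distribution.intro prob_spaceI real_distribution_axioms.intro) simp_all
    qed
    have ch: "char (density lborel (\<lambda>t. ennreal (f t / m))) \<eta> = of_real (1 / m) * (LINT t|lborel. of_real (f t) * cis (\<eta> * t))"
      if [measurable]: "f \<in> borel_measurable borel" and f: "\<And>t. f t \<ge> 0" for f \<eta>
    proof -
      have "char (density lborel (\<lambda>t. ennreal (f t / m))) \<eta> = (LINT t|lborel. (f t / m) *\<^sub>R iexp (\<eta> * t))"
        unfolding char_def using f m by (subst integral_density) simp_all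
      also have "\<dots> = (LINT t|lborel. of_real (1 / m) * (of_real (f t) * cis (\<eta> * t)))"
        by (intro Bochner_Integration.integral_cong[OF refl]) (simp add: scaleR_conv_of_real cis_conv_exp)
      finally show ?thesis by (simp only: integral_mult_right_zero)
    qed
    have "density lborel (\<lambda>t. ennreal (p t / m)) = density lborel (\<lambda>t. ennreal (q t / m))"
      using p q p0 q0 mq by (intro Levy_uniqueness dist ext) (simp_all add: m_def[symmetric] ch F)
    then have "AE t in lborel. ennreal (p t / m) = ennreal (q t / m)"
      by (subst (asm) sigma_finite_measure.density_unique_iff[OF sigma_finite_lborel]) simp_all
    then show ?thesis
      by eventually_elim (use m p0 q0 in \<open>simp add: rpq\<close>)
  qed
qed

theorem ft_unique:
  assumes h: "integrable lborel h" and z: "\<And>\<eta>. ft h \<eta> = 0"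
  shows "AE t in lborel. h t = 0"
proof -
  have i: "integrable lborel (\<lambda>t. h t * cis (- (\<eta> * t)))" for \<eta>
    using h by (intro ft_integrable) simp_all
  have ic: "integrable lborel (\<lambda>t. cnj (h t) * cis (- (\<eta> * t)))" for \<eta>
    using h by (intro ft_integrable) simp_all
  have zc: "ft (\<lambda>t. cnj (h t)) \<eta> = 0" for \<eta>
  proof -
    have "ft (\<lambda>t. cnj (h t)) \<eta> = (LINT t|lborel. cnj (h t * cis (- (- \<eta> * t))))"
      unfolding ft_def by (simp add: cis_cnj)
    also have "\<dots> = cnj (ft h (- \<eta>))"
      by (simp only: ft_def Bochner_Integration.integral_cnj)
    finally show ?thesis using z by simp
  qed
  have "ft (\<lambda>t. of_real (Re (h t))) \<eta> = 0" for \<eta>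
  proof -
    have "ft (\<lambda>t. of_real (Re (h t))) \<eta> = (LINT t|lborel. (1/2) * (h t * cis (- (\<eta> * t)) + cnj (h t) * cis (- (\<eta> * t))))"
      unfolding ft_def
    proof (rule Bochner_Integration.integral_cong[OF refl])
      fix t
      have "of_real (Re (h t)) = (1/2) * (h t + cnj (h t))" by (simp add: complex_add_cnj)
      then show "of_real (Re (h t)) * cis (- (\<eta> * t)) = (1/2) * (h t * cis (- (\<eta> * t)) + cnj (h t) * cis (- (\<eta> * t)))"
        by (simp only: mult.assoc distrib_right)
    qed
    also have "\<dots> = (1/2) * (ft h \<eta> + ft (\<lambda>t. cnj (h t)) \<eta>)"
      unfolding ft_def using i[of \<eta>] ic[of \<eta>] by simp
    finally show ?thesis using z zc by simp
  qed
  then have "AE t in lborel. Re (h t) = 0" using h by (intro ft_unique_real) simp_all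
  moreover have "ft (\<lambda>t. of_real (Im (h t))) \<eta> = 0" for \<eta>
  proof -
    have "ft (\<lambda>t. of_real (Im (h t))) \<eta> = (LINT t|lborel. (- \<i>/2) * (h t * cis (- (\<eta> * t)) - cnj (h t) * cis (- (\<eta> * t))))"
      unfolding ft_def
    proof (rule Bochner_Integration.integral_cong[OF refl])
      fix t
      have "of_real (Im (h t)) = (- \<i>/2) * (h t - cnj (h t))" by (simp add: complex_eq_iff)
      then show "of_real (Im (h t)) * cis (- (\<eta> * t)) = (- \<i>/2) * (h t * cis (- (\<eta> * t)) - cnj (h t) * cis (- (\<eta> * t)))"
        by (simp add: left_diff_distrib)
    qed
    also have "\<dots> = (- \<i>/2) * (ft h \<eta> - ft (\<lambda>t. cnj (h t)) \<eta>)"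
      unfolding ft_def using i[of \<eta>] ic[of \<eta>] by simp
    finally show ?thesis using z zc by simp
  qed
  then have "AE t in lborel. Im (h t) = 0" using h by (intro ft_unique_real) simp_all
  ultimately show ?thesis by eventually_elim (simp add: complex_eq_iff)
qed

text \<open>
  Expanding the exponential and integrating termwise gives an everywhere convergent power series.
\<close>
lemma ft_compact_support_entire:
  assumes h: "integrable lborel h" and supp: "\<And>t. h t \<noteq> 0 \<Longrightarrow> \<bar>t\<bar> \<le> R"
  shows "\<exists>H. H holomorphic_on UNIV \<and> (\<forall>\<eta>. H (of_real \<eta>) = ft h \<eta>)"
proof -
  have [measurable]: "h \<in> borel_measurable borel" using borel_measurable_integrable[OF h] by simp
  define H where "H z = (LINT t|lborel. h t * exp (- \<i> * z * of_real t))" for z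
  define f where "f z n t = h t * ((- \<i> * z * of_real t) ^ n /\<^sub>R fact n)" for z n and t :: real
  define a where "a n = (LINT t|lborel. h t * ((- \<i> * of_real t) ^ n /\<^sub>R fact n))" for n
  have nf: "norm (f z n t) \<le> cmod (h t) * ((cmod z * \<bar>R\<bar>) ^ n /\<^sub>R fact n)" for z n t
  proof (cases "h t = 0")
    case False
    then have "\<bar>t\<bar> \<le> \<bar>R\<bar>" using supp[of t] by simp
    then show ?thesis
      by (auto simp: f_def norm_mult norm_power intro!: mult_left_mono power_mono mult_mono)
  qed (simp add: f_def)
  have fi: "integrable lborel (f z n)" for z n
  proof (rule Bochner_Integration.integrable_bound)
    show "integrable lborel (\<lambda>t. cmod (h t) * ((cmod z * \<bar>R\<bar>) ^ n /\<^sub>R fact n))" using h by simp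
    show "f z n \<in> borel_measurable lborel" unfolding f_def[abs_def] by measurable
    show "AE t in lborel. norm (f z n t) \<le> norm (cmod (h t) * ((cmod z * \<bar>R\<bar>) ^ n /\<^sub>R fact n))"
      by (intro AE_I2 order_trans[OF nf]) simp
  qed
  have "(\<lambda>n. a n * (z - 0) ^ n) sums H z" for z
  proof -
    have "(\<lambda>n. LINT t|lborel. f z n t) sums (LINT t|lborel. (\<Sum>n. f z n t))"
    proof (rule sums_integral[OF fi])
      show "AE t in lborel. summable (\<lambda>n. norm (f z n t))"
      proof (rule AE_I2)
        fix t
        have "summable (\<lambda>n. cmod (h t) * ((cmod z * \<bar>R\<bar>) ^ n /\<^sub>R fact n))"
          by (intro summable_mult summable_exp_generic)
        then show "summable (\<lambda>n. norm (f z n t))"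
          by (rule summable_comparison_test'[where N = 0]) (use nf[of z _ t] in \<open>simp only: real_norm_def abs_norm_cancel\<close>)
      qed
      have "summable (\<lambda>n. (LINT t|lborel. cmod (h t)) * ((cmod z * \<bar>R\<bar>) ^ n /\<^sub>R fact n))"
        by (intro summable_mult summable_exp_generic)
      then show "summable (\<lambda>n. LINT t|lborel. norm (f z n t))"
      proof (rule summable_comparison_test'[where N = 0])
        fix n
        have "(LINT t|lborel. norm (f z n t)) \<le> (LINT t|lborel. cmod (h t) * ((cmod z * \<bar>R\<bar>) ^ n /\<^sub>R fact n))"
          using fi[of z n] h nf by (intro integral_mono) auto
        then show "norm (LINT t|lborel. norm (f z n t)) \<le> (LINT t|lborel. cmod (h t)) * ((cmod z * \<bar>R\<bar>) ^ n /\<^sub>R fact n)"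
          by simp
      qed
    qed
    moreover have "(LINT t|lborel. f z n t) = a n * (z - 0) ^ n" for n
    proof -
      have "f z n t = (h t * ((- \<i> * of_real t) ^ n /\<^sub>R fact n)) * (z - 0) ^ n" for t
      proof -
        have "- \<i> * z * of_real t = (- \<i> * of_real t) * z" by simp
        then show ?thesis unfolding f_def by (simp only: power_mult_distrib) (simp add: scaleR_conv_of_real)
      qed
      then show ?thesis unfolding a_def by (simp only: integral_mult_left_zero)
    qed
    moreover have "(\<Sum>n. f z n t) = h t * exp (- \<i> * z * of_real t)" for t
      unfolding f_def exp_def by (rule suminf_mult) (rule summable_exp_generic)
    ultimately show ?thesis by (simp add: H_def)
  qed
  then have "H holomorphic_on ball 0 r" for r
    by (intro power_series_holomorphic) auto
  then have "H holomorphic_on (\<Union>r::real. ball 0 r)"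
    by (intro holomorphic_on_UN_open) auto
  moreover have "(\<Union>r::real. ball (0::complex) r) = UNIV"
  proof -
    have "z \<in> (\<Union>r::real. ball (0::complex) r)" for z
      by (rule UN_I[of "norm z + 1"]) simp_all
    then show ?thesis by blast
  qed
  moreover have "H (of_real \<eta>) = ft h \<eta>" for \<eta>
    unfolding H_def ft_def by (simp add: cis_conv_exp mult.assoc)
  ultimately show ?thesis by metis
qed

lemma ft_eq_0_of_accumulation:
  assumes h: "integrable lborel h" and supp: "\<And>t. h t \<noteq> 0 \<Longrightarrow> \<bar>t\<bar> \<le> R"
    and y: "\<And>n. ft h (y n) = 0" "\<And>n. y n \<noteq> y0" "y \<longlonglongrightarrow> y0"
  shows "ft h \<eta> = 0"
proof -
  obtain H where H: "H holomorphic_on UNIV" "\<And>\<eta>. H (of_real \<eta>) = ft h \<eta>"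
    using ft_compact_support_entire[OF h supp] by blast
  have "H (of_real \<eta>) = 0"
  proof (rule analytic_continuation[OF H(1), where U = "range (\<lambda>n. complex_of_real (y n))" and \<xi> = "of_real y0"])
    show "complex_of_real y0 islimpt range (\<lambda>n. complex_of_real (y n))"
      unfolding islimpt_sequential using y(2,3)
      by (intro exI[of _ "\<lambda>n. complex_of_real (y n)"]) (auto intro: tendsto_of_real)
  qed (use y(1) H(2) in auto)
  then show ?thesis by (simp add: H(2))
qed

section \<open>Fourier coefficients of functions supported on a period\<close>

text \<open>
  For \<open>h\<close> supported on one period \<open>2 * pi / \<bar>\<omega>\<bar>\<close>, the values in question are its Fourier coefficients up to normalisation.
\<close>
definition vanishing_coeffs :: "real \<Rightarrow> (real \<Rightarrow> complex) \<Rightarrow> bool" where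
  "vanishing_coeffs \<omega> h \<longleftrightarrow> integrable lborel h \<and> (\<forall>k::int. ft h (\<omega> * of_int k) = 0)"

lemma vanishing_coeffs_add:
  assumes "vanishing_coeffs \<omega> f" "vanishing_coeffs \<omega> g"
  shows "vanishing_coeffs \<omega> (\<lambda>t. f t + g t)"
proof -
  have f: "integrable lborel f" and g: "integrable lborel g" using assms by (simp_all add: vanishing_coeffs_def)
  have "integrable lborel (\<lambda>t. f t * cis (- (\<eta> * t)))" "integrable lborel (\<lambda>t. g t * cis (- (\<eta> * t)))" for \<eta>
    using f g by (auto intro!: ft_integrable)
  then have "ft (\<lambda>t. f t + g t) \<eta> = ft f \<eta> + ft g \<eta>" for \<eta>
    by (simp add: ft_def distrib_right)
  then show ?thesis using assms f g by (simp add: vanishing_coeffs_def)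
qed

lemma vanishing_coeffs_cmult:
  assumes "vanishing_coeffs \<omega> f"
  shows "vanishing_coeffs \<omega> (\<lambda>t. c * f t)"
proof -
  have "ft (\<lambda>t. c * f t) \<eta> = c * ft f \<eta>" for \<eta>
    by (simp only: ft_def mult.assoc integral_mult_right_zero)
  then show ?thesis using assms by (simp add: vanishing_coeffs_def)
qed

lemma vanishing_coeffs_cis:
  assumes "vanishing_coeffs \<omega> h"
  shows "vanishing_coeffs \<omega> (\<lambda>t. cis (\<omega> * of_int j * t) * h t)"
proof -
  have "ft (\<lambda>t. cis (\<omega> * of_int j * t) * h t) (\<omega> * of_int k) = ft h (\<omega> * of_int (k - j))" for k
    unfolding ft_def
  proof (rule Bochner_Integration.integral_cong[OF refl])
    fix t
    have "cis (\<omega> * of_int j * t) * cis (- (\<omega> * of_int k * t)) = cis (- (\<omega> * of_int (k - j) * t))"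
      unfolding cis_mult by (rule arg_cong[of _ _ cis]) (simp add: algebra_simps)
    then show "cis (\<omega> * of_int j * t) * h t * cis (- (\<omega> * of_int k * t)) = h t * cis (- (\<omega> * of_int (k - j) * t))"
      by (simp add: mult.assoc mult.left_commute)
  qed
  moreover have "integrable lborel (\<lambda>t. cis (\<omega> * of_int j * t) * h t)"
  proof -
    have "(\<lambda>t. cis (\<omega> * of_int j * t) * h t) = (\<lambda>t. h t * cis (\<omega> * of_int j * t))"
      by (rule ext, rule mult.commute)
    then show ?thesis using assms by (simp add: vanishing_coeffs_def ft_integrable)
  qed
  moreover have "ft h (\<omega> * of_int (k - j)) = 0" for k
    using assms unfolding vanishing_coeffs_def by blast
  ultimately show ?thesis unfolding vanishing_coeffs_def by (simp only: simp_thms)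
qed

text \<open>
  The class of functions with vanishing coefficients is a module over the trigonometric polynomials: a linear
  function of \<open>cis \<theta>\<close> combines the shifts of the coefficients by one place, and products are handled by iteration, which is
  why \<open>h\<close> is generalised in the induction.
\<close>
lemma vanishing_coeffs_polynomial:
  assumes "real_polynomial_function p" "vanishing_coeffs \<omega> h"
  shows "vanishing_coeffs \<omega> (\<lambda>t. of_real (p (cis (\<omega> * t))) * h t)"
  using assms
proof (induction p arbitrary: h rule: real_polynomial_function.induct)
  case (linear f)
  \<comment> \<open>Write \<open>cos \<theta> * f 1 + sin \<theta> * f \<i>\<close> in terms of the two characters \<open>cis \<theta>\<close> and \<open>cis (- \<theta>)\<close>.\<close>
  define c where "c = (of_real (f 1) - \<i> * of_real (f \<i>)) / 2"
  define d where "d = (of_real (f 1) + \<i> * of_real (f \<i>)) / 2"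
  have lin: "complex_of_real (f (cis \<theta>)) = c * cis \<theta> + d * cis (- \<theta>)" for \<theta>
  proof -
    interpret bounded_linear f by fact
    have "cis \<theta> = cos \<theta> *\<^sub>R 1 + sin \<theta> *\<^sub>R \<i>" by (simp add: complex_eq_iff)
    then have "f (cis \<theta>) = cos \<theta> * f 1 + sin \<theta> * f \<i>" by (simp only: add scaleR real_scaleR_def)
    then show ?thesis by (simp add: complex_eq_iff c_def d_def field_simps)
  qed
  have "vanishing_coeffs \<omega> (\<lambda>t. c * (cis (\<omega> * of_int 1 * t) * h t) + d * (cis (\<omega> * of_int (- 1) * t) * h t))"
    by (intro vanishing_coeffs_add vanishing_coeffs_cmult vanishing_coeffs_cis linear)
  then show ?case by (simp add: lin algebra_simps)
next
  case (const r)
  then show ?case by (rule vanishing_coeffs_cmult)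
next
  case (add f g)
  then show ?case by (simp add: distrib_right vanishing_coeffs_add)
next
  case (mult f g)
  have "vanishing_coeffs \<omega> (\<lambda>t. of_real (f (cis (\<omega> * t))) * (of_real (g (cis (\<omega> * t))) * h t))"
    by (intro mult)
  then show ?case by (simp add: mult.assoc)
qed

text \<open>
  By the Stone-Weierstrass theorem on the circle, \<open>\<phi>\<close> is a uniform limit of polynomials \<open>p\<close>, for which the
  integral is the coefficient of index 0 of \<open>p * h\<close>.
\<close>
lemma vanishing_coeffs_continuous_real:
  assumes h: "vanishing_coeffs \<omega> h" and \<phi>: "continuous_on (sphere 0 1) \<phi>"
    and m: "(\<lambda>t. \<phi> (cis (\<omega> * t))) \<in> borel_measurable borel"
  shows "(LINT t|lborel. complex_of_real (\<phi> (cis (\<omega> * t))) * h t) = 0"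
proof -
  have hi: "integrable lborel h" using h by (simp add: vanishing_coeffs_def)
  note [measurable] = m borel_measurable_integrable[OF hi]
  let ?I = "LINT t|lborel. complex_of_real (\<phi> (cis (\<omega> * t))) * h t"
  have "cmod ?I \<le> 0 + e" if "e > 0" for e
  proof -
    define K where "K = (LINT t|lborel. cmod (h t))"
    have K: "K \<ge> 0" unfolding K_def by (rule integral_nonneg_AE) simp
    \<comment> \<open>The summand 1 guards against \<open>h = 0\<close>.\<close>
    define d where "d = e / (K + 1)"
    have d: "d > 0" using \<open>e > 0\<close> K by (simp add: d_def)
    obtain p where p: "real_polynomial_function p" "\<And>z. z \<in> sphere 0 1 \<Longrightarrow> \<bar>\<phi> z - p z\<bar> < d"
      using Stone_Weierstrass_real_polynomial_function[OF compact_sphere \<phi> d] by blast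
    have v: "vanishing_coeffs \<omega> (\<lambda>t. of_real (p (cis (\<omega> * t))) * h t)"
      by (rule vanishing_coeffs_polynomial[OF p(1) h])
    then have pi: "integrable lborel (\<lambda>t. of_real (p (cis (\<omega> * t))) * h t)"
      by (simp add: vanishing_coeffs_def)
    have "ft (\<lambda>t. of_real (p (cis (\<omega> * t))) * h t) (\<omega> * of_int 0) = 0"
      using v unfolding vanishing_coeffs_def by blast
    then have p0: "(LINT t|lborel. of_real (p (cis (\<omega> * t))) * h t) = 0" by (simp add: ft_def)
    have mp: "(\<lambda>t. p (cis (\<omega> * t))) \<in> borel_measurable borel"
      by (intro borel_measurable_continuous_onI continuous_on_compose2[OF continuous_on_polymonial_function[of p UNIV]] continuous_intros)
        (simp_all add: real_polynomial_function_eq[symmetric] p)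
    note [measurable] = mp
    have diff: "cmod ((complex_of_real (\<phi> (cis (\<omega> * t))) - of_real (p (cis (\<omega> * t)))) * h t) \<le> d * cmod (h t)" for t
    proof -
      have "\<bar>\<phi> (cis (\<omega> * t)) - p (cis (\<omega> * t))\<bar> \<le> d" using p(2)[of "cis (\<omega> * t)"] by simp
      then show ?thesis
        unfolding norm_mult of_real_diff[symmetric] norm_of_real by (intro mult_right_mono) simp_all
    qed
    have di: "integrable lborel (\<lambda>t. (complex_of_real (\<phi> (cis (\<omega> * t))) - of_real (p (cis (\<omega> * t)))) * h t)"
    proof (rule Bochner_Integration.integrable_bound)
      show "integrable lborel (\<lambda>t. d * cmod (h t))" using hi by simp
      show "AE t in lborel. norm ((complex_of_real (\<phi> (cis (\<omega> * t))) - of_real (p (cis (\<omega> * t)))) * h t) \<le> norm (d * cmod (h t))"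
        by (intro AE_I2 order_trans[OF diff]) simp
    qed measurable
    have "?I = (LINT t|lborel. (complex_of_real (\<phi> (cis (\<omega> * t))) - of_real (p (cis (\<omega> * t)))) * h t + of_real (p (cis (\<omega> * t))) * h t)"
      by (intro Bochner_Integration.integral_cong[OF refl]) (simp add: algebra_simps)
    also have "\<dots> = (LINT t|lborel. (complex_of_real (\<phi> (cis (\<omega> * t))) - of_real (p (cis (\<omega> * t)))) * h t)"
      using di pi p0 by simp
    also have "cmod \<dots> \<le> (LINT t|lborel. d * cmod (h t))"
      using diff hi di by (intro Bochner_Integration.integral_norm_bound_integral) simp_all
    also have "\<dots> = d * K" by (simp add: K_def)
    also have "\<dots> \<le> e" using \<open>e > 0\<close> K by (simp add: d_def field_simps)
    finally show ?thesis by simp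
  qed
  then have "cmod ?I \<le> 0" by (rule field_le_epsilon)
  then show ?thesis by simp
qed

lemma vanishing_coeffs_continuous:
  fixes \<phi> :: "complex \<Rightarrow> complex"
  assumes h: "vanishing_coeffs \<omega> h" and \<phi>: "continuous_on (sphere 0 1) \<phi>"
  shows "(LINT t|lborel. \<phi> (cis (\<omega> * t)) * h t) = 0"
proof -
  have hi: "integrable lborel h" using h by (simp add: vanishing_coeffs_def)
  have m: "(\<lambda>t. \<phi> (cis (\<omega> * t))) \<in> borel_measurable borel"
    by (intro borel_measurable_continuous_onI continuous_on_compose2[OF \<phi>] continuous_intros) auto
  note [measurable] = m borel_measurable_integrable[OF hi]
  have "bounded (\<phi> ` sphere 0 1)"
    by (intro compact_imp_bounded compact_continuous_image \<phi> compact_sphere)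
  then obtain B where "\<forall>w\<in>\<phi> ` sphere 0 1. cmod w \<le> B"
    unfolding bounded_iff by blast
  then have B: "\<And>z. z \<in> sphere 0 1 \<Longrightarrow> cmod (\<phi> z) \<le> B" by blast
  have "integrable lborel (\<lambda>t. of_real (g (\<phi> (cis (\<omega> * t)))) * h t)"
    if [measurable]: "g \<in> borel_measurable borel" and g: "\<And>z. \<bar>g z\<bar> \<le> cmod z" for g :: "complex \<Rightarrow> real"
  proof (rule Bochner_Integration.integrable_bound)
    show "integrable lborel (\<lambda>t. B * cmod (h t))" using hi by simp
    show "AE t in lborel. norm (of_real (g (\<phi> (cis (\<omega> * t)))) * h t) \<le> norm (B * cmod (h t))"
    proof (intro AE_I2)
      fix t
      have "\<bar>g (\<phi> (cis (\<omega> * t)))\<bar> \<le> \<bar>B\<bar>" using g[of "\<phi> (cis (\<omega> * t))"] B[of "cis (\<omega> * t)"] by simp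
      then show "norm (of_real (g (\<phi> (cis (\<omega> * t)))) * h t) \<le> norm (B * cmod (h t))"
        by (simp add: norm_mult abs_mult mult_right_mono)
    qed
  qed measurable
  from this[of Re] this[of Im] have i: "integrable lborel (\<lambda>t. of_real (Re (\<phi> (cis (\<omega> * t)))) * h t)"
    "integrable lborel (\<lambda>t. of_real (Im (\<phi> (cis (\<omega> * t)))) * h t)"
    by (simp_all add: abs_Re_le_cmod abs_Im_le_cmod)
  have "(LINT t|lborel. \<phi> (cis (\<omega> * t)) * h t) =
     (LINT t|lborel. of_real (Re (\<phi> (cis (\<omega> * t)))) * h t + \<i> * (of_real (Im (\<phi> (cis (\<omega> * t)))) * h t))"
    by (intro Bochner_Integration.integral_cong[OF refl])
      (metis complex_eq distrib_right mult.assoc)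
  also have "\<dots> = (LINT t|lborel. of_real (Re (\<phi> (cis (\<omega> * t)))) * h t) + \<i> * (LINT t|lborel. of_real (Im (\<phi> (cis (\<omega> * t)))) * h t)"
    using i by simp
  also have "\<dots> = 0"
    using vanishing_coeffs_continuous_real[OF h, of "\<lambda>z. Re (\<phi> z)"] vanishing_coeffs_continuous_real[OF h, of "\<lambda>z. Im (\<phi> z)"] \<phi>
    by (simp add: continuous_on_Re continuous_on_Im)
  finally show ?thesis .
qed

text \<open>
  The function \<open>cis (c * Arg z)\<close> jumps at \<open>-1\<close>; the first factor suppresses the jump and, away from that
  point, equals 1 for large \<open>n\<close>.
\<close>
lemma continuous_on_damped_Arg_power:
  "continuous_on (sphere 0 1) (\<lambda>z. of_real (min 1 (real n * cmod (1 + z))) * cis (c * Arg z))"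
  (is "continuous_on _ ?\<phi>")
proof (intro continuous_at_imp_continuous_on ballI)
  fix z :: complex assume z: "z \<in> sphere 0 1"
  show "isCont ?\<phi> z"
  proof (cases "z = -1")
    case True
    have "(?\<phi> \<longlongrightarrow> 0) (at (-1))"
    proof (rule Lim_null_comparison)
      show "\<forall>\<^sub>F z in at (-1). norm (?\<phi> z) \<le> real n * cmod (1 + z)"
        by (intro always_eventually allI) (simp add: norm_mult)
      have "((\<lambda>z::complex. real n * cmod (1 + z)) \<longlongrightarrow> real n * cmod (1 + -1)) (at (-1))"
        by (intro tendsto_intros)
      then show "((\<lambda>z::complex. real n * cmod (1 + z)) \<longlongrightarrow> 0) (at (-1))" by simp
    qed
    then show ?thesis using True by (simp add: isCont_def)
  next
    case False
    have "z \<notin> \<real>\<^sub>\<le>\<^sub>0"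
    proof
      assume "z \<in> \<real>\<^sub>\<le>\<^sub>0"
      then obtain r where "z = of_real r" "r \<le> 0" by (auto simp: nonpos_Reals_def)
      then show False using z False by simp
    qed
    then have "isCont Arg z" by (rule continuous_at_Arg)
    then show ?thesis unfolding cis_conv_exp by (intro continuous_intros) simp_all
  qed
qed

text \<open>
  On the support of \<open>h\<close> the character \<open>cis (- (\<eta> * t))\<close> is a function of \<open>cis (\<omega> * t)\<close>, continuous except at
  the ends of the period. It is a bounded pointwise limit of continuous functions on the circle.
\<close>
lemma ft_eq_0_of_vanishing_coeffs:
  assumes \<omega>: "\<omega> \<noteq> 0" and h: "vanishing_coeffs \<omega> h" and supp: "\<And>t. h t \<noteq> 0 \<Longrightarrow> \<bar>\<omega> * t\<bar> \<le> pi"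
  shows "ft h \<eta> = 0"
proof -
  have hi: "integrable lborel h" using h by (simp add: vanishing_coeffs_def)
  note [measurable] = borel_measurable_integrable[OF hi]
  define \<phi> where "\<phi> n z = of_real (min 1 (real n * cmod (1 + z))) * cis (- (\<eta> / \<omega>) * Arg z)" for n z
  have \<phi>: "continuous_on (sphere 0 1) (\<phi> n)" for n
    unfolding \<phi>_def[abs_def] by (rule continuous_on_damped_Arg_power)
  have [measurable]: "(\<lambda>t. \<phi> n (cis (\<omega> * t))) \<in> borel_measurable borel" for n
    by (intro borel_measurable_continuous_onI continuous_on_compose2[OF \<phi>] continuous_intros) auto
  have "(\<lambda>n. LINT t|lborel. \<phi> n (cis (\<omega> * t)) * h t) \<longlonglongrightarrow> (LINT t|lborel. cis (- (\<eta> * t)) * h t)"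
  proof (rule integral_dominated_convergence[where w = "\<lambda>t. cmod (h t)"])
    have "countable {pi / \<omega>, - pi / \<omega>}" by simp
    then have "AE t in lborel. t \<notin> {pi / \<omega>, - pi / \<omega>}"
      by (intro AE_not_in countable_imp_null_set_lborel)
    then show "AE t in lborel. (\<lambda>n. \<phi> n (cis (\<omega> * t)) * h t) \<longlonglongrightarrow> cis (- (\<eta> * t)) * h t"
    proof (rule AE_mp, intro AE_I2 impI)
      fix t assume t: "t \<notin> {pi / \<omega>, - pi / \<omega>}"
      show "(\<lambda>n. \<phi> n (cis (\<omega> * t)) * h t) \<longlonglongrightarrow> cis (- (\<eta> * t)) * h t"
      proof (cases "h t = 0")
        case False
        then have "\<bar>\<omega> * t\<bar> \<le> pi" by (rule supp)
        moreover have "\<omega> * t \<noteq> pi" "\<omega> * t \<noteq> - pi" using t \<omega> by (auto simp: field_simps)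
        ultimately have lt: "- pi < \<omega> * t" "\<omega> * t < pi" by auto
        then have Arg: "Arg (cis (\<omega> * t)) = \<omega> * t"
          by (intro cis_Arg_unique) (simp_all add: sgn_div_norm)
        have "cis (\<omega> * t) \<noteq> -1"
        proof
          assume "cis (\<omega> * t) = -1"
          then have "Arg (-1) = \<omega> * t" using Arg by simp
          moreover have "Arg (-1) = pi" by (rule cis_Arg_unique) (simp_all add: sgn_div_norm)
          ultimately show False using lt by simp
        qed
        then have pos: "cmod (1 + cis (\<omega> * t)) > 0" by (metis add.commute add_eq_0_iff zero_less_norm_iff)
        obtain N where N: "1 < real N * cmod (1 + cis (\<omega> * t))"
          using reals_Archimedean3[OF pos] by blast
        have "\<phi> n (cis (\<omega> * t)) = cis (- (\<eta> * t))" if "n \<ge> N" for n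
        proof -
          have "real N * cmod (1 + cis (\<omega> * t)) \<le> real n * cmod (1 + cis (\<omega> * t))"
            using that by (intro mult_right_mono) simp_all
          then show ?thesis using N \<omega> by (simp add: \<phi>_def Arg min_def)
        qed
        then show ?thesis
          by (intro tendsto_eventually) (auto simp: eventually_sequentially)
      qed simp
    qed
    show "AE t in lborel. norm (\<phi> n (cis (\<omega> * t)) * h t) \<le> cmod (h t)" for n
    proof (intro AE_I2)
      fix t
      have "cmod (\<phi> n (cis (\<omega> * t))) \<le> 1" by (simp add: \<phi>_def norm_mult)
      from mult_right_mono[OF this, of "cmod (h t)"] show "norm (\<phi> n (cis (\<omega> * t)) * h t) \<le> cmod (h t)"
        by (simp add: norm_mult)
    qed
  qed (use hi in simp_all)
  then have "(\<lambda>n::nat. 0) \<longlonglongrightarrow> (LINT t|lborel. cis (- (\<eta> * t)) * h t)"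
    by (simp only: vanishing_coeffs_continuous[OF h \<phi>])
  then have "(LINT t|lborel. cis (- (\<eta> * t)) * h t) = 0"
    by (intro LIMSEQ_unique[OF _ tendsto_const])
  then show ?thesis by (simp add: ft_def mult.commute)
qed

lemma ft_shift: "ft (\<lambda>t. h (t + m)) \<eta> = cis (\<eta> * m) * ft h \<eta>"
proof -
  have "ft (\<lambda>t. h (t + m)) \<eta> = (LINT t|lborel. cis (\<eta> * m) * (h (t + m) * cis (- (\<eta> * (t + m)))))"
    unfolding ft_def
  proof (rule Bochner_Integration.integral_cong[OF refl])
    fix t
    have "cis (- (\<eta> * t)) = cis (\<eta> * m) * cis (- (\<eta> * (t + m)))"
      unfolding cis_mult by (rule arg_cong[of _ _ cis]) (simp add: algebra_simps)
    then show "h (t + m) * cis (- (\<eta> * t)) = cis (\<eta> * m) * (h (t + m) * cis (- (\<eta> * (t + m))))" by simp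
  qed
  also have "\<dots> = cis (\<eta> * m) * (LINT t|lborel. h (t + m) * cis (- (\<eta> * (t + m))))"
    by (rule integral_mult_right_zero)
  also have "(LINT t|lborel. h (t + m) * cis (- (\<eta> * (t + m)))) = ft h \<eta>"
    unfolding ft_def by (rule shift_integral)
  finally show ?thesis .
qed

lemma ft_eq_0_of_fourier_coefficients:
  assumes \<omega>: "\<omega> \<noteq> 0" and h: "integrable lborel h"
    and supp: "\<And>t. h t \<noteq> 0 \<Longrightarrow> \<bar>\<omega> * (t - m)\<bar> \<le> pi"
    and coeffs: "\<And>k::int. ft h (\<omega> * of_int k) = 0"
  shows "ft h \<eta> = 0"
proof -
  have "ft (\<lambda>t. h (t + m)) \<eta> = 0"
  proof (rule ft_eq_0_of_vanishing_coeffs[OF \<omega>])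
    show "vanishing_coeffs \<omega> (\<lambda>t. h (t + m))"
      using h coeffs by (simp add: vanishing_coeffs_def shift_integrable ft_shift)
    fix t assume "h (t + m) \<noteq> 0"
    from supp[OF this] show "\<bar>\<omega> * t\<bar> \<le> pi" by simp
  qed
  then show ?thesis by (simp add: ft_shift)
qed

section \<open>Recovery up to a constant phase\<close>

text \<open>
  The real line is Lindelof, so countably many of the open sets in question cover the complement of the support.
\<close>
lemma AE_zero_outside_ess_support: "AE t in lebesgue. t \<notin> ess_support u \<longrightarrow> u t = 0"
proof -
  let ?F = "{U. open U \<and> (AE x in lebesgue. x \<in> U \<longrightarrow> u x = 0)}"
  obtain F' where F': "F' \<subseteq> ?F" "countable F'" "\<Union>F' = \<Union>?F"
    using Lindelof[of ?F] by blast
  have "AE x in lebesgue. \<forall>U\<in>F'. x \<in> U \<longrightarrow> u x = 0"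
    using F'(1,2) by (subst AE_ball_countable) auto
  then show ?thesis
    by eventually_elim (use F'(3) in \<open>auto simp: ess_support_def\<close>)
qed

lemma L2_borel_version_bounded_support:
  assumes u: "u \<in> L2" and supp: "ess_support u \<subseteq> {-R..R}"
  shows "\<exists>u'. sqint u' \<and> (AE t in lebesgue. u t = u' t) \<and> (\<forall>t. u' t \<noteq> 0 \<longrightarrow> \<bar>t\<bar> \<le> R)"
proof -
  obtain u' where u': "sqint u'" "AE t in lebesgue. u t = u' t"
    using L2_borel_version[OF u] by blast
  note [measurable] = sqint_measurable[OF u'(1)]
  let ?v = "\<lambda>t. if \<bar>t\<bar> \<le> R then u' t else 0"
  have "sqint ?v" by (rule sqint_bound[OF u'(1)]) simp_all
  moreover have "AE t in lebesgue. u t = ?v t"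
    using u'(2) AE_zero_outside_ess_support[of u]
  proof eventually_elim
    case (elim t)
    show ?case
    proof (cases "\<bar>t\<bar> \<le> R")
      case False
      then have "t \<notin> {-R..R}" by auto
      then have "t \<notin> ess_support u" using supp by blast
      then show ?thesis using elim False by simp
    qed (use elim in simp)
  qed
  ultimately show ?thesis by (intro exI[of _ ?v]) simp
qed

lemma AE_ex_nonzero:
  assumes "AE t in M. Q t" "\<not> (AE t in M. f t = 0)"
  shows "\<exists>t. Q t \<and> f t \<noteq> 0"
proof (rule ccontr)
  assume "\<not> (\<exists>t. Q t \<and> f t \<noteq> 0)"
  then have "AE t in M. f t = 0" using assms(1) by (auto elim: eventually_mono)
  with assms(2) show False by simp
qed

lemma AE_zero_of_tensor_square_zero:
  fixes u :: "real \<Rightarrow> complex"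
  assumes "AE t in lborel. AE s in lborel. u s * cnj (u t) = 0"
  shows "AE s in lborel. u s = 0"
proof (rule ccontr)
  assume nz: "\<not> (AE s in lborel. u s = 0)"
  then obtain t where t: "AE s in lborel. u s * cnj (u t) = 0" "u t \<noteq> 0"
    using AE_ex_nonzero[OF assms] by blast
  from t(1) have "AE s in lborel. u s = 0" by eventually_elim (use t(2) in simp)
  with nz show False by simp
qed

text \<open>
  Freezing \<open>t\<close> at a generic point where \<open>v\<close> does not vanish shows \<open>v = c * u\<close>; inserting this back gives
  \<open>\<bar>c\<bar>\<^sup>2 = 1\<close> unless \<open>u = 0\<close>.
\<close>
lemma tensor_square_determines_up_to_phase:
  fixes u v :: "real \<Rightarrow> complex"
  assumes eq: "AE t in lborel. AE s in lborel. u s * cnj (u t) = v s * cnj (v t)"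
  shows "\<exists>c. cmod c = 1 \<and> (AE s in lborel. v s = c * u s)"
proof (cases "AE s in lborel. v s = 0")
  case True
  have "AE t in lborel. AE s in lborel. u s * cnj (u t) = 0"
    using eq
  proof eventually_elim
    case (elim t)
    then show ?case using True by eventually_elim simp
  qed
  then have "AE s in lborel. u s = 0" by (rule AE_zero_of_tensor_square_zero)
  with True have "AE s in lborel. v s = 1 * u s" by eventually_elim simp
  then show ?thesis by (intro exI[of _ 1]) simp
next
  case False
  then obtain t0 where t0: "AE s in lborel. u s * cnj (u t0) = v s * cnj (v t0)" "v t0 \<noteq> 0"
    using AE_ex_nonzero[OF eq] by blast
  define c where "c = cnj (u t0) / cnj (v t0)"
  have vc: "AE s in lborel. v s = c * u s"
    using t0(1) by eventually_elim (use t0(2) in \<open>simp add: c_def field_simps\<close>)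
  have u0: "\<not> (AE s in lborel. u s = 0)"
  proof
    assume "AE s in lborel. u s = 0"
    with vc have "AE s in lborel. v s = 0" by eventually_elim simp
    with False show False by simp
  qed
  have "c * cnj c = 1"
  proof (rule ccontr)
    assume c: "c * cnj c \<noteq> 1"
    have "AE t in lborel. AE s in lborel. u s * cnj (u t) = 0"
      using eq vc
    proof eventually_elim
      case (elim t)
      from elim(1) vc show ?case
      proof eventually_elim
        case (elim s)
        have "u s * cnj (u t) = (c * cnj c) * (u s * cnj (u t))"
          using elim \<open>v t = c * u t\<close> by simp
        then have "(1 - c * cnj c) * (u s * cnj (u t)) = 0" by (simp only: left_diff_distrib) simp
        then show ?case using c by (simp only: mult_eq_0_iff) auto
      qed
    qed
    then show False using AE_zero_of_tensor_square_zero u0 by blast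
  qed
  then have "complex_of_real ((cmod c)\<^sup>2) = 1" by (simp only: complex_norm_square)
  then have "(cmod c)\<^sup>2 = 1" by (simp only: of_real_eq_1_iff)
  then have "cmod c = 1" by (simp add: power2_eq_1_iff) (use norm_ge_zero[of c] in linarith)
  with vc show ?thesis by blast
qed

text \<open>
  The differences vanish in \<open>t\<close> for each fixed nonzero \<open>x\<close>; exchanging the order of the two almost everywhere
  quantifiers and translating turns this into a statement about almost all pairs \<open>(s, t)\<close>.
\<close>
lemma ft_shift_product_diff_determines:
  assumes u: "sqint u'" "AE t in lebesgue. u t = u' t"
    and v: "sqint v'" "AE t in lebesgue. v t = v' t"
    and z: "\<And>x \<eta>. x \<noteq> 0 \<Longrightarrow> ft (shift_product_diff u' v' x) \<eta> = 0"
  shows "\<exists>c. cmod c = 1 \<and> (AE t in lebesgue. v t = c * u t)"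
proof -
  note [measurable] = sqint_measurable[OF u(1)] sqint_measurable[OF v(1)]
  have "AE t in lborel. shift_product_diff u' v' x t = 0" if "x \<noteq> 0" for x
    by (rule ft_unique[OF shift_product_diff_integrable[OF u(1) v(1)] z[OF that]])
  moreover have "AE x in lborel. (x::real) \<noteq> 0"
    using AE_lborel_singleton[of "0::real"] .
  ultimately have "AE x in lborel. AE t in lborel. shift_product_diff u' v' x t = 0"
    by (auto elim: eventually_mono)
  then have "AE t in lborel. AE x in lborel. shift_product_diff u' v' x t = 0"
    by (subst (asm) lborel_pair.AE_commute) (unfold shift_product_diff_def, measurable)
  then have "AE t in lborel. AE s in lborel. u' s * cnj (u' t) = v' s * cnj (v' t)"
  proof eventually_elim
    case (elim t)
    have "Measurable.pred borel (\<lambda>x. shift_product_diff u' v' x t = 0)"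
      unfolding shift_product_diff_def by measurable
    from AE_borel_affine[OF _ this elim, of 1 "- t"] show ?case
      by (simp add: shift_product_diff_def)
  qed
  then obtain c where c: "cmod c = 1" "AE s in lborel. v' s = c * u' s"
    using tensor_square_determines_up_to_phase by blast
  have "AE t in lebesgue. v t = c * u t"
    using AE_completion[OF c(2)] u(2) v(2) by eventually_elim simp
  with c(1) show ?thesis by blast
qed

lemma shift_product_diff_support:
  assumes "\<And>t. u t \<noteq> 0 \<Longrightarrow> \<bar>t\<bar> \<le> R" "\<And>t. v t \<noteq> 0 \<Longrightarrow> \<bar>t\<bar> \<le> R"
    and "shift_product_diff u v x t \<noteq> 0"
  shows "\<bar>t\<bar> \<le> R \<and> \<bar>t + x\<bar> \<le> R"
proof -
  have "u (t + x) \<noteq> 0 \<and> u t \<noteq> 0 \<or> v (t + x) \<noteq> 0 \<and> v t \<noteq> 0"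
    using assms(3) by (auto simp: shift_product_diff_def)
  then show ?thesis using assms(1,2) by blast
qed

lemma cot_arctan: "z \<noteq> 0 \<Longrightarrow> cot (arctan z) = 1 / z" "z \<noteq> 0 \<Longrightarrow> sin (arctan z) \<noteq> 0"
  by (simp_all add: cot_altdef tan_arctan field_simps sin_arctan) (use sum_power2_gt_zero_iff[of 1 z] in simp)

lemma ex_angle_with_cot:
  "\<exists>\<alpha>\<in>{-(pi/2)..pi/2}. sin \<alpha> \<noteq> 0 \<and> cot \<alpha> = y"
proof (cases "y = 0")
  case True
  then show ?thesis by (intro bexI[of _ "pi/2"]) (auto simp: cot_def)
next
  case False
  then show ?thesis
    using cot_arctan[of "1 / y"] arctan_bounded[of "1 / y"] by (intro bexI[of _ "arctan (1/y)"]) auto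
qed

lemma cot_sample_angle:
  assumes "a > 0"
  shows "sin (sample_angle a k) \<noteq> 0" "cot (sample_angle a k) = of_int k / a\<^sup>2"
  using cot_arctan[of "a\<^sup>2 / of_int k"] assms
  by (simp_all add: sample_angle_def cot_def)

lemma cot_eq_imp_eq:
  assumes "sin a \<noteq> 0" "sin b \<noteq> 0" "cot a = cot b" "\<bar>a - b\<bar> < pi"
  shows "a = (b::real)"
proof (rule ccontr)
  assume "a \<noteq> b"
  have "sin (a - b) = 0"
    using assms(1-3) by (simp add: cot_def sin_diff field_simps)
  moreover have "sin (a - b) \<noteq> 0"
  proof (cases "a > b")
    case True
    then show ?thesis using sin_gt_zero[of "a - b"] assms(4) by simp
  next
    case False
    then show ?thesis using sin_gt_zero[of "b - a"] assms(4) \<open>a \<noteq> b\<close> sin_minus[of "b - a"] by simp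
  qed
  ultimately show False by simp
qed

lemma sin_nonzero_in_half_period:
  assumes "\<alpha> \<in> {-(pi/2)..pi/2}" "\<alpha> \<noteq> 0"
  shows "sin \<alpha> \<noteq> 0"
proof (cases "\<alpha> > 0")
  case True
  then show ?thesis using sin_gt_zero[of \<alpha>] assms pi_gt_zero by simp
next
  case False
  then show ?thesis using sin_gt_zero[of "- \<alpha>"] assms pi_gt_zero by simp
qed

text \<open>
  A bounded set that accumulates at most at 0 has finitely many points outside each neighbourhood of 0,
  hence is countable and null.
\<close>
lemma positive_measure_imp_nonzero_limpt:
  fixes \<tau> :: "real set"
  assumes sub: "\<tau> \<subseteq> {-r..r}" and pos: "emeasure lebesgue \<tau> > 0"
  shows "\<exists>\<alpha>0. \<alpha>0 \<noteq> 0 \<and> \<alpha>0 islimpt \<tau>"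
proof (rule ccontr)
  assume no: "\<not> ?thesis"
  define S where "S n = \<tau> \<inter> {\<alpha>. 1 / real (Suc n) \<le> \<bar>\<alpha>\<bar>}" for n
  have fin: "finite (S n)" for n
  proof (rule ccontr)
    assume "infinite (S n)"
    moreover have "bounded (S n)"
      by (rule bounded_subset[OF bounded_closed_interval[of "-r" r]]) (use sub in \<open>auto simp: S_def\<close>)
    ultimately obtain \<alpha> where \<alpha>: "\<alpha> islimpt S n"
      using bounded_infinite_imp_islimpt[OF subset_refl] by blast
    have "closed {\<alpha>. 1 / real (Suc n) \<le> \<bar>\<alpha>\<bar>}"
      by (intro closed_Collect_le continuous_intros)
    then have "1 / real (Suc n) \<le> \<bar>\<alpha>\<bar>"
      using \<alpha> islimpt_subset[of \<alpha> "S n" "{\<alpha>. 1 / real (Suc n) \<le> \<bar>\<alpha>\<bar>}"] unfolding closed_limpt S_def by blast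
    then have "\<alpha> \<noteq> 0" by auto
    moreover have "\<alpha> islimpt \<tau>" by (rule islimpt_subset[OF \<alpha>]) (simp add: S_def)
    ultimately show False using no by blast
  qed
  have "\<tau> \<subseteq> insert 0 (\<Union>n. S n)"
  proof
    fix \<alpha> assume \<alpha>: "\<alpha> \<in> \<tau>"
    show "\<alpha> \<in> insert 0 (\<Union>n. S n)"
    proof (cases "\<alpha> = 0")
      case False
      then have "0 < \<bar>\<alpha>\<bar>" by simp
      from reals_Archimedean[OF this] obtain n where "inverse (real (Suc n)) < \<bar>\<alpha>\<bar>" by blast
      then have "\<alpha> \<in> S n" using \<alpha> by (simp add: S_def inverse_eq_divide)
      then show ?thesis by blast
    qed simp
  qed
  moreover have "countable (insert 0 (\<Union>n. S n))"
    using fin by (auto intro: countable_finite)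
  ultimately have "countable \<tau>" by (rule countable_subset)
  then have "\<tau> \<in> null_sets lebesgue"
    by (intro null_sets_completionI countable_imp_null_set_lborel)
  then show False using pos by (simp add: null_sets_def)
qed

text \<open>
  The cotangent is injective near \<open>\<alpha>0\<close>, but not on the whole interval, since it vanishes at both
  endpoints. Hence the sequence is cut off until it lies within distance \<open>pi\<close> of its limit.
\<close>
lemma ex_seq_cot_accumulation:
  assumes sub: "\<tau> \<subseteq> {-(pi/2)..pi/2}" and lim: "\<alpha>0 \<noteq> 0" "\<alpha>0 islimpt \<tau>"
  shows "\<exists>f. (\<forall>n::nat. f n \<in> \<tau> \<and> sin (f n) \<noteq> 0 \<and> cot (f n) \<noteq> cot \<alpha>0) \<and> (\<lambda>n. cot (f n)) \<longlonglongrightarrow> cot \<alpha>0"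
proof -
  have "\<alpha>0 islimpt {-(pi/2)..pi/2}" by (rule islimpt_subset[OF lim(2) sub])
  then have "\<alpha>0 \<in> {-(pi/2)..pi/2}" using closed_limpt[of "{-(pi/2)..pi/2}"] by simp
  then have s0: "sin \<alpha>0 \<noteq> 0" using lim(1) by (rule sin_nonzero_in_half_period)
  obtain f where f: "\<And>n::nat. f n \<in> \<tau> - {\<alpha>0}" "f \<longlonglongrightarrow> \<alpha>0"
    using lim(2) unfolding islimpt_sequential by blast
  have "eventually (\<lambda>n. f n \<noteq> 0) sequentially"
    using f(2) lim(1) by (rule tendsto_imp_eventually_ne)
  moreover have "eventually (\<lambda>n. dist (f n) \<alpha>0 < pi) sequentially"
    using f(2) pi_gt_zero by (rule tendstoD)
  ultimately have "eventually (\<lambda>n. f n \<noteq> 0 \<and> dist (f n) \<alpha>0 < pi) sequentially"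
    by (rule eventually_conj)
  then obtain N where N: "\<And>n. n \<ge> N \<Longrightarrow> f n \<noteq> 0 \<and> dist (f n) \<alpha>0 < pi"
    unfolding eventually_sequentially by blast
  have "f (n + N) \<in> \<tau> \<and> sin (f (n + N)) \<noteq> 0 \<and> cot (f (n + N)) \<noteq> cot \<alpha>0" for n
  proof -
    have 1: "f (n + N) \<in> \<tau>" "f (n + N) \<noteq> \<alpha>0" using f(1)[of "n + N"] by auto
    have 2: "f (n + N) \<noteq> 0" "\<bar>f (n + N) - \<alpha>0\<bar> < pi" using N[of "n + N"] by (auto simp: dist_real_def)
    have 3: "sin (f (n + N)) \<noteq> 0" using 1 2 sub by (intro sin_nonzero_in_half_period) auto
    then show ?thesis using 1 2 cot_eq_imp_eq[OF 3 s0] by blast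
  qed
  moreover have "(\<lambda>n. cot (f (n + N))) \<longlonglongrightarrow> cot \<alpha>0"
    by (rule LIMSEQ_ignore_initial_segment[OF isCont_tendsto_compose[OF isCont_cot[OF s0] f(2)]])
  ultimately show ?thesis by (intro exI[of _ "\<lambda>n. f (n + N)"]) blast
qed

theorem uniqueness_all_angles:
  assumes u: "u \<in> L2" and v: "v \<in> L2"
    and eq: "\<And>\<alpha>. \<alpha> \<in> {-(pi/2)..pi/2} \<Longrightarrow> AE \<xi> in lebesgue. cmod (frft \<alpha> v \<xi>) = cmod (frft \<alpha> u \<xi>)"
  shows "\<exists>c. cmod c = 1 \<and> (AE x in lebesgue. v x = c * u x)"
proof -
  obtain u' where u': "sqint u'" "AE t in lebesgue. u t = u' t" using L2_borel_version[OF u] by blast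
  obtain v' where v': "sqint v'" "AE t in lebesgue. v t = v' t" using L2_borel_version[OF v] by blast
  show ?thesis
  proof (rule ft_shift_product_diff_determines[OF u' v'])
    fix x \<eta> :: real assume x: "x \<noteq> 0"
    obtain \<alpha> where \<alpha>: "\<alpha> \<in> {-(pi/2)..pi/2}" "sin \<alpha> \<noteq> 0" "cot \<alpha> = \<eta> / (2 * pi * x)"
      using ex_angle_with_cot by blast
    have "ft (shift_product_diff u' v' x) (2 * pi * x * cot \<alpha>) = 0"
      by (rule ft_shift_product_diff_eq_0[OF u u' v v' \<alpha>(2) eq[OF \<alpha>(1)]])
    then show "ft (shift_product_diff u' v' x) \<eta> = 0" using x by (simp add: \<alpha>(3))
  qed
qed

theorem uniqueness_accumulating_angles:
  assumes u: "u \<in> L2" "compact (ess_support u)" and v: "v \<in> L2" "compact (ess_support v)"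
    and \<tau>: "\<tau> \<subseteq> {-(pi/2)..pi/2}" "\<alpha>0 \<noteq> 0" "\<alpha>0 islimpt \<tau>"
    and eq: "\<And>\<alpha>. \<alpha> \<in> \<tau> \<Longrightarrow> AE \<xi> in lebesgue. cmod (frft \<alpha> v \<xi>) = cmod (frft \<alpha> u \<xi>)"
  shows "\<exists>c. cmod c = 1 \<and> (AE x in lebesgue. v x = c * u x)"
proof -
  have "bounded (ess_support u \<union> ess_support v)" using u v by (simp add: compact_imp_bounded)
  then obtain R where R: "\<And>t. t \<in> ess_support u \<union> ess_support v \<Longrightarrow> \<bar>t\<bar> \<le> R"
    unfolding bounded_iff real_norm_def by blast
  have R': "t \<in> {-R..R}" if "t \<in> ess_support u \<union> ess_support v" for t
    using R[OF that] by auto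
  obtain u' where u': "sqint u'" "AE t in lebesgue. u t = u' t" "\<And>t. u' t \<noteq> 0 \<Longrightarrow> \<bar>t\<bar> \<le> R"
    using L2_borel_version_bounded_support[OF u(1) subsetI[OF R']] by blast
  obtain v' where v': "sqint v'" "AE t in lebesgue. v t = v' t" "\<And>t. v' t \<noteq> 0 \<Longrightarrow> \<bar>t\<bar> \<le> R"
    using L2_borel_version_bounded_support[OF v(1) subsetI[OF R']] by blast
  obtain f where f: "\<And>n::nat. f n \<in> \<tau>" "\<And>n. sin (f n) \<noteq> 0" "\<And>n. cot (f n) \<noteq> cot \<alpha>0"
    "(\<lambda>n. cot (f n)) \<longlonglongrightarrow> cot \<alpha>0"
    using ex_seq_cot_accumulation[OF \<tau>] by blast
  show ?thesis
  proof (rule ft_shift_product_diff_determines[OF u'(1,2) v'(1,2)])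
    fix x \<eta> :: real assume x: "x \<noteq> 0"
    show "ft (shift_product_diff u' v' x) \<eta> = 0"
    proof (rule ft_eq_0_of_accumulation[where R = R and y = "\<lambda>n. 2 * pi * x * cot (f n)" and ?y0.0 = "2 * pi * x * cot \<alpha>0"])
      show "integrable lborel (shift_product_diff u' v' x)"
        by (rule shift_product_diff_integrable[OF u'(1) v'(1)])
      show "\<bar>t\<bar> \<le> R" if "shift_product_diff u' v' x t \<noteq> 0" for t
        using shift_product_diff_support[OF u'(3) v'(3) that] by blast
      show "ft (shift_product_diff u' v' x) (2 * pi * x * cot (f n)) = 0" for n
        by (rule ft_shift_product_diff_eq_0[OF u(1) u'(1,2) v(1) v'(1,2) f(2) eq[OF f(1)]])
      show "2 * pi * x * cot (f n) \<noteq> 2 * pi * x * cot \<alpha>0" for n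
        using f(3) x by simp
      show "(\<lambda>n. 2 * pi * x * cot (f n)) \<longlonglongrightarrow> 2 * pi * x * cot \<alpha>0"
        by (intro tendsto_intros f(4))
    qed
  qed
qed

text \<open>
  For a fixed shift \<open>x\<close> the relevant function lives on the interval of half-length \<open>a - \<bar>x\<bar> / 2\<close> around
  \<open>- x / 2\<close>, and the angles provide its Fourier transform at the integer multiples of \<open>2 * pi * x / a\<^sup>2\<close>. That
  this sampling is dense enough for every \<open>x\<close> is the inequality \<open>\<bar>x\<bar> * (2 * a - \<bar>x\<bar>) \<le> a\<^sup>2\<close>.
\<close>
theorem uniqueness_sampled_angles:
  assumes a: "a > 0" and u: "u \<in> L2" "ess_support u \<subseteq> {-a..a}" and v: "v \<in> L2" "ess_support v \<subseteq> {-a..a}"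
    and eq: "\<And>k::int. AE \<xi> in lebesgue. cmod (frft (sample_angle a k) v \<xi>) = cmod (frft (sample_angle a k) u \<xi>)"
  shows "\<exists>c. cmod c = 1 \<and> (AE x in lebesgue. v x = c * u x)"
proof -
  obtain u' where u': "sqint u'" "AE t in lebesgue. u t = u' t" "\<And>t. u' t \<noteq> 0 \<Longrightarrow> \<bar>t\<bar> \<le> a"
    using L2_borel_version_bounded_support[OF u] by blast
  obtain v' where v': "sqint v'" "AE t in lebesgue. v t = v' t" "\<And>t. v' t \<noteq> 0 \<Longrightarrow> \<bar>t\<bar> \<le> a"
    using L2_borel_version_bounded_support[OF v] by blast
  show ?thesis
  proof (rule ft_shift_product_diff_determines[OF u'(1,2) v'(1,2)])
    fix x \<eta> :: real assume x: "x \<noteq> 0"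
    show "ft (shift_product_diff u' v' x) \<eta> = 0"
    proof (rule ft_eq_0_of_fourier_coefficients[where \<omega> = "2 * pi * x / a\<^sup>2" and m = "- x / 2"])
      show "2 * pi * x / a\<^sup>2 \<noteq> 0" using a x by simp
      show "integrable lborel (shift_product_diff u' v' x)"
        by (rule shift_product_diff_integrable[OF u'(1) v'(1)])
      show "ft (shift_product_diff u' v' x) (2 * pi * x / a\<^sup>2 * of_int k) = 0" for k :: int
        using ft_shift_product_diff_eq_0[OF u(1) u'(1,2) v(1) v'(1,2) cot_sample_angle(1)[OF a] eq, of x k]
        by (simp add: cot_sample_angle(2)[OF a])
      fix t assume "shift_product_diff u' v' x t \<noteq> 0"
      then have "\<bar>t\<bar> \<le> a" "\<bar>t + x\<bar> \<le> a"
        using shift_product_diff_support[OF u'(3) v'(3)] by blast+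
      then have "\<bar>t - - x / 2\<bar> \<le> a - \<bar>x\<bar> / 2" by linarith
      then have "2 * (\<bar>x\<bar> * \<bar>t - - x / 2\<bar>) \<le> 2 * (\<bar>x\<bar> * (a - \<bar>x\<bar> / 2))"
        by (intro mult_left_mono) simp_all
      \<comment> \<open>This is \<open>(a - \<bar>x\<bar>)\<^sup>2 \<ge> 0\<close>.\<close>
      also have "\<dots> \<le> a\<^sup>2"
        using zero_le_power2[of "a - \<bar>x\<bar>"] by (simp add: power2_eq_square algebra_simps)
      finally have "2 * (\<bar>x\<bar> * \<bar>t - - x / 2\<bar>) / a\<^sup>2 \<le> 1" using a by simp
      then have "pi * (2 * (\<bar>x\<bar> * \<bar>t - - x / 2\<bar>) / a\<^sup>2) \<le> pi * 1"
        by (intro mult_left_mono) simp_all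
      moreover have "\<bar>2 * pi * x / a\<^sup>2 * d\<bar> = pi * (2 * (\<bar>x\<bar> * \<bar>d\<bar>) / a\<^sup>2)" for d
        by (simp add: abs_mult)
      ultimately show "\<bar>2 * pi * x / a\<^sup>2 * (t - - x / 2)\<bar> \<le> pi"
        by (simp only: mult_1_right)
    qed
  qed
qed

theorem theorem5p1:
  shows
  "(\<forall>u\<in>L2. \<forall>v\<in>L2.
      (\<forall>\<alpha>\<in>{-(pi/2)..pi/2}. AE \<xi> in lebesgue. cmod (frft \<alpha> v \<xi>) = cmod (frft \<alpha> u \<xi>)) \<longrightarrow>
      (\<exists>c::complex. cmod c = 1 \<and> (AE x in lebesgue. v x = c * u x)))
   \<and>
   (\<forall>\<tau>::real set. \<tau> \<subseteq> {-(pi/2)..pi/2} \<longrightarrow>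
      (\<tau> \<in> sets lebesgue \<and> emeasure lebesgue \<tau> > 0) \<or> (\<exists>\<alpha>0. \<alpha>0 \<noteq> 0 \<and> \<alpha>0 islimpt \<tau>) \<longrightarrow>
      (\<forall>u\<in>L2. \<forall>v\<in>L2. compact (ess_support u) \<longrightarrow> compact (ess_support v) \<longrightarrow>
         (\<forall>\<alpha>\<in>\<tau>. AE \<xi> in lebesgue. cmod (frft \<alpha> v \<xi>) = cmod (frft \<alpha> u \<xi>)) \<longrightarrow>
         (\<exists>c::complex. cmod c = 1 \<and> (AE x in lebesgue. v x = c * u x))))
   \<and>
   (\<forall>a::real. a > 0 \<longrightarrow>
      (\<forall>u\<in>L2. \<forall>v\<in>L2.
         compact (ess_support u) \<and> ess_support u \<subseteq> {-a..a} \<longrightarrow>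
         compact (ess_support v) \<and> ess_support v \<subseteq> {-a..a} \<longrightarrow>
         (\<forall>k::int. AE \<xi> in lebesgue.
            cmod (frft (sample_angle a k) v \<xi>) = cmod (frft (sample_angle a k) u \<xi>)) \<longrightarrow>
         (\<exists>c::complex. cmod c = 1 \<and> (AE x in lebesgue. v x = c * u x))))"
proof (intro conjI allI ballI impI)
  fix u v :: "real \<Rightarrow> complex"
  assume "u \<in> L2" "v \<in> L2"
    and "\<forall>\<alpha>\<in>{-(pi/2)..pi/2}. AE \<xi> in lebesgue. cmod (frft \<alpha> v \<xi>) = cmod (frft \<alpha> u \<xi>)"
  then show "\<exists>c::complex. cmod c = 1 \<and> (AE x in lebesgue. v x = c * u x)"
    by (intro uniqueness_all_angles) simp_all
next
  fix \<tau> :: "real set" and u v :: "real \<Rightarrow> complex"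
  assume \<tau>: "\<tau> \<subseteq> {-(pi/2)..pi/2}"
    "(\<tau> \<in> sets lebesgue \<and> emeasure lebesgue \<tau> > 0) \<or> (\<exists>\<alpha>0. \<alpha>0 \<noteq> 0 \<and> \<alpha>0 islimpt \<tau>)"
    and uv: "u \<in> L2" "v \<in> L2" "compact (ess_support u)" "compact (ess_support v)"
    and eq: "\<forall>\<alpha>\<in>\<tau>. AE \<xi> in lebesgue. cmod (frft \<alpha> v \<xi>) = cmod (frft \<alpha> u \<xi>)"
  have "\<exists>\<alpha>0. \<alpha>0 \<noteq> 0 \<and> \<alpha>0 islimpt \<tau>"
    using \<tau>(2) positive_measure_imp_nonzero_limpt[of \<tau> "pi/2"] \<tau>(1) by blast
  then obtain \<alpha>0 where "\<alpha>0 \<noteq> 0" "\<alpha>0 islimpt \<tau>" by blast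
  with uv \<tau>(1) eq show "\<exists>c::complex. cmod c = 1 \<and> (AE x in lebesgue. v x = c * u x)"
    by (intro uniqueness_accumulating_angles[of u v \<tau> \<alpha>0]) auto
next
  fix a :: real and u v :: "real \<Rightarrow> complex"
  assume a: "a > 0" and uv: "u \<in> L2" "v \<in> L2" "compact (ess_support u) \<and> ess_support u \<subseteq> {-a..a}"
      "compact (ess_support v) \<and> ess_support v \<subseteq> {-a..a}"
    and eq: "\<forall>k::int. AE \<xi> in lebesgue.
            cmod (frft (sample_angle a k) v \<xi>) = cmod (frft (sample_angle a k) u \<xi>)"
  show "\<exists>c::complex. cmod c = 1 \<and> (AE x in lebesgue. v x = c * u x)"
    by (rule uniqueness_sampled_angles[OF a]) (use uv eq in simp_all)
qed

end
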